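(* Let $a\geq 1$ and $k\geq 4$ be integers with $k$ even, and let $b=ak+2$. Let $T$ be a tree with $k$ interior vertices and $b$ leaves. Then $$\lambda_1(T)\ \leq\ \frac{k+4a+2-\sqrt{(k+2)^2-16}}{4}.$$ Equality holds if and only if $T$ is (isomorphic to) one of the star-like path trees $SLP\left(a+1,a;1;\frac{k-2}{2},\frac{k-2}{2}\right)$, $SLP\left(a+1,a;2;\frac{k-4}{2},\frac{k-2}{2}\right)$, or $SLP\left(a+1,a;3;\frac{k-4}{2},\frac{k-4}{2}\right)$.
   Context: For a finite tree $T=(V,E)$ with at least three vertices, the boundary $B$ is the set of leaves (degree-one vertices) and the interior is $\Omega=V\setminus B$; interior vertices are the non-leaf vertices. The first Dirichlet eigenvalue $\lambda_1(T)$ is the smallest $\lambda$ for which there is a nonzero $f:V\to\mathbb{R}$ with $f=0$ on $B$ and $\sum_{y\sim x}(f(x)-f(y))=\lambda f(x)$ for all $x\in\Omega$. Star-like path tree: for integers $q\geq1$ and $p,c,d,e\geq 0$, $SLP(p,q;c;d,e)$ is the tree obtained as follows. Take a path $u_0\sim u_1\sim\cdots\sim u_c$ of length $c$ (a single vertex $u_0=u_c$ if $c=0$). Attach $d$ new vertices $u_{0,1},\dots,u_{0,d}$ to $u_0$ and $e$ new vertices $u_{c,1},\dots,u_{c,e}$ to $u_c$. Then attach $p$ leaves to each vertex of the set $\{u_0,u_c\}$, and attach $q$ leaves to each of the vertices $u_{0,i}$ ($1\le i\le d$), $u_{c,j}$ ($1\le j\le e$), and $u_1,\dots,u_{c-1}$.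 *)

theory Defs
  imports Complex_Main "Graph_Theory.Graph_Theory"
begin

text \<open>
  A finite simple graph is a symmetric loop-free finite digraph (locale \<^locale>\<open>pair_graph\<close>),
  so every undirected edge is a pair of opposite arcs. In this encoding the walk u, v, u along
  one edge is a digraph cycle, so the library predicate \<^const>\<open>tree\<close> is not the notion of an
  undirected tree; the cycles of the undirected graph are the digraph cycles of length at least three.
\<close>

definition tree_graph :: "'a pair_pre_digraph \<Rightarrow> bool" where
  "tree_graph T \<longleftrightarrow> pair_graph T \<and> Digraph_Component.connected (with_proj T) \<and>
     \<not> (\<exists>p. pre_digraph.cycle (with_proj T) p \<and> length p \<ge> 3)"

definition nbrs :: "'a pair_pre_digraph \<Rightarrow> 'a \<Rightarrow> 'a set" where
  "nbrs T x = {y. (x, y) \<in> parcs T}"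

definition leaves :: "'a pair_pre_digraph \<Rightarrow> 'a set" where
  "leaves T = {x \<in> pverts T. card (nbrs T x) = 1}"

definition interior_verts :: "'a pair_pre_digraph \<Rightarrow> 'a set" where
  "interior_verts T = pverts T - leaves T"

definition dirichlet_eigenvalue :: "'a pair_pre_digraph \<Rightarrow> real \<Rightarrow> bool" where
  "dirichlet_eigenvalue T \<mu> \<longleftrightarrow>
     (\<exists>f :: 'a \<Rightarrow> real.
        (\<exists>x \<in> pverts T. f x \<noteq> 0) \<and>
        (\<forall>x \<in> leaves T. f x = 0) \<and>
        (\<forall>x \<in> interior_verts T. (\<Sum>y \<in> nbrs T x. f x - f y) = \<mu> * f x))"

definition first_dirichlet_eigenvalue :: "'a pair_pre_digraph \<Rightarrow> real" where
  "first_dirichlet_eigenvalue T = (LEAST \<mu>. dirichlet_eigenvalue T \<mu>)"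

text \<open>
  Vertices of star-like path trees: \<open>Spine i\<close> is $u_i$, \<open>ArmL i\<close> is $u_{0,i}$,
  \<open>ArmR j\<close> is $u_{c,j}$, and \<open>Pendant w l\<close> is the $l$-th leaf attached to $w$.
\<close>

datatype slp_vertex = Spine nat | ArmL nat | ArmR nat | Pendant slp_vertex nat

definition slp_core :: "nat \<Rightarrow> nat \<Rightarrow> nat \<Rightarrow> slp_vertex set" where
  "slp_core c d e = Spine ` {0..c} \<union> ArmL ` {1..d} \<union> ArmR ` {1..e}"

definition slp_pendants :: "nat \<Rightarrow> nat \<Rightarrow> nat \<Rightarrow> slp_vertex \<Rightarrow> nat" where
  "slp_pendants p q c w = (if w \<in> {Spine 0, Spine c} then p else q)"

definition slp_edges :: "nat \<Rightarrow> nat \<Rightarrow> nat \<Rightarrow> nat \<Rightarrow> nat \<Rightarrow> slp_vertex rel" where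
  "slp_edges p q c d e =
     {(Spine i, Spine (Suc i)) | i. i < c} \<union>
     {(Spine 0, ArmL i) | i. i \<in> {1..d}} \<union>
     {(Spine c, ArmR j) | j. j \<in> {1..e}} \<union>
     {(w, Pendant w l) | w l. w \<in> slp_core c d e \<and> l \<in> {1..slp_pendants p q c w}}"

definition SLP :: "nat \<Rightarrow> nat \<Rightarrow> nat \<Rightarrow> nat \<Rightarrow> nat \<Rightarrow> slp_vertex pair_pre_digraph" where
  "SLP p q c d e =
     \<lparr> pverts = slp_core c d e \<union>
         {Pendant w l | w l. w \<in> slp_core c d e \<and> l \<in> {1..slp_pendants p q c w}},
       parcs = slp_edges p q c d e \<union> (slp_edges p q c d e)\<inverse> \<rparr>"

definition graph_isomorphic :: "'a pair_pre_digraph \<Rightarrow> 'b pair_pre_digraph \<Rightarrow> bool" where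
  "graph_isomorphic G H \<longleftrightarrow> digraph_iso (with_proj G) (with_proj H)"

end

theory Submission
  imports Defs "HOL-Analysis.Function_Topology"
begin

text \<open>
  On the interior tree, $\lambda_1 - a$ is the least eigenvalue $\nu$ of the Laplacian plus the charge
  $m(x) = \ell(x) - a$, where $\ell(x)$ counts the leaves at $x$; the total charge is 2. Let $f > 0$ be
  an eigenfunction. Dividing the equation at $x$ by $f(x)$ and summing over a vertex set $C$ expresses
  $\nu |C|$ through the charge of $C$, the ratios $r = f(y)/f(x)$ along the edges leaving $C$, and
  minus the sum of $r + 1/r - 2$ over the edges inside $C$.

  Put $k = 2h$, let $\mu$ be the claimed bound minus $a$, so that $\mu^2 - (h+1)\mu + 1 = 0$, and suppose
  $\nu \ge \mu$. Call an edge bad if $1 - \mu < r < 1/(1 - \mu)$; every other edge contributes at least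
  $\tau = \mu^2/(1 - \mu)$. Cutting a bad edge splits the charge into $1 + 1$. The summation over the part
  between two bad edges shows that it is a single vertex, and the larger of the two outer parts, which
  has at least $h$ vertices since $2h - 1$ is odd, then gives a contradiction. So at most one edge is bad,
  and $k \nu \le 2 - (k - 2) \tau = k \mu$. In the case of equality there is one edge with $r = 1$ and all
  other ratios are $(1 - \mu)^{\pm 1}$; the equation at a vertex then leaves only centres of stars with
  $h$ vertices and charge 1, and their uncharged arms. The edge with $r = 1$ joins two such stars, at
  centres or at arms.
\<close>

section \<open>Ground states of weighted graphs\<close>

text \<open>\<open>w\<close> is a potential of arbitrary sign: first the number of leaves at an
  interior vertex, later that number minus \<open>a\<close>.\<close>

locale weighted_graph =
  fixes S :: "'a set" and E :: "'a rel" and w :: "'a \<Rightarrow> real"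
  assumes finite_S: "finite S" and S_nonempty: "S \<noteq> {}"
    and E_sub: "E \<subseteq> S \<times> S" and E_sym: "sym E"
    and E_conn: "\<lbrakk>x \<in> S; y \<in> S\<rbrakk> \<Longrightarrow> (x, y) \<in> E\<^sup>*"
begin

definition lap :: "('a \<Rightarrow> real) \<Rightarrow> 'a \<Rightarrow> real" where
  "lap f x = (\<Sum>y \<in> E `` {x}. f x - f y) + w x * f x"

definition form :: "('a \<Rightarrow> real) \<Rightarrow> ('a \<Rightarrow> real) \<Rightarrow> real" where
  "form f g = (\<Sum>x\<in>S. f x * lap g x)"

lemma finite_E: "finite E"
  using E_sub finite_S finite_subset by blast

lemma finite_nb [simp]: "finite (E `` {x})"
  using finite_E by (simp add: finite_Image)

lemma nb_sub: "E `` {x} \<subseteq> S"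
  using E_sub by blast

lemma E_symD: "(x, y) \<in> E \<Longrightarrow> (y, x) \<in> E"
  using E_sym by (auto dest: symD)

lemma sum_nb_swap:
  assumes "C \<subseteq> S"
  shows "(\<Sum>x\<in>C. \<Sum>y\<in>E `` {x} \<inter> C. g x y) = (\<Sum>x\<in>C. \<Sum>y\<in>E `` {x} \<inter> C. g y x)"
proof -
  have fC: "finite C" using assms finite_S finite_subset by blast
  have "(\<Sum>x\<in>C. \<Sum>y\<in>E `` {x} \<inter> C. g x y) = (\<Sum>x\<in>C. \<Sum>y\<in>C. if (x, y) \<in> E then g x y else 0)"
    by (intro sum.cong refl sum.mono_neutral_cong_left fC) auto
  also have "\<dots> = (\<Sum>y\<in>C. \<Sum>x\<in>C. if (y, x) \<in> E then g x y else 0)"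
    by (subst sum.swap) (intro sum.cong refl, auto dest: E_symD)
  also have "\<dots> = (\<Sum>x\<in>C. \<Sum>y\<in>E `` {x} \<inter> C. g y x)"
    by (intro sum.cong refl sum.mono_neutral_cong_right fC) auto
  finally show ?thesis .
qed

lemma sum_nb_swap_S: "(\<Sum>x\<in>S. \<Sum>y\<in>E `` {x}. g x y) = (\<Sum>x\<in>S. \<Sum>y\<in>E `` {x}. g y x)"
proof -
  have "E `` {x} \<inter> S = E `` {x}" for x using nb_sub by blast
  with sum_nb_swap[of S g] show ?thesis by simp
qed

lemma form_eq:
  "form f g = (\<Sum>x\<in>S. \<Sum>y\<in>E `` {x}. f x * g x - f x * g y) + (\<Sum>x\<in>S. w x * f x * g x)"
  by (simp add: form_def lap_def sum.distrib sum_distrib_left algebra_simps)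

lemma form_sym: "form f g = form g f"
proof -
  have "(\<Sum>x\<in>S. \<Sum>y\<in>E `` {x}. f x * g y) = (\<Sum>x\<in>S. \<Sum>y\<in>E `` {x}. g x * f y)"
    by (subst sum_nb_swap_S) (simp add: mult.commute)
  then show ?thesis
    by (simp add: form_eq sum_subtractf mult.commute mult.left_commute)
qed

lemma lap_add_mult: "lap (\<lambda>x. f x + t * g x) x = lap f x + t * lap g x"
  by (simp add: lap_def sum_distrib_left sum.distrib algebra_simps flip: sum.distrib)

lemma form_add_mult_right: "form h (\<lambda>x. f x + t * g x) = form h f + t * form h g"
  by (simp add: form_def lap_add_mult sum_distrib_left sum.distrib algebra_simps)

lemma form_add_mult:
  "form (\<lambda>x. f x + t * g x) (\<lambda>x. f x + t * g x) = form f f + 2 * t * form g f + t\<^sup>2 * form g g"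
  by (simp add: form_add_mult_right form_sym[of "\<lambda>x. f x + t * g x"] form_sym[of f g]
      algebra_simps power2_eq_square)

lemma form_delta: "z \<in> S \<Longrightarrow> form (\<lambda>x. if x = z then 1 else 0) f = lap f z"
  by (simp add: form_def finite_S if_distrib[of "\<lambda>c. c * _"] cong: if_cong)

lemma form_cong: "(\<And>x. x \<in> S \<Longrightarrow> f x = f' x) \<Longrightarrow> form f f = form f' f'"
  unfolding form_def lap_def using nb_sub by (intro sum.cong refl arg_cong2[where f = "(*)"]
      arg_cong2[where f = "(+)"]) (auto intro!: sum.cong)

text \<open>The diagonal terms do not change, and -|f x| |f y| \<le> - f x * f y for every arc.
  Hence a minimiser may be replaced by its absolute value.\<close>

lemma form_abs_le: "form (\<lambda>x. \<bar>f x\<bar>) (\<lambda>x. \<bar>f x\<bar>) \<le> form f f"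
  unfolding form_eq
  by (intro add_mono sum_mono) (auto simp: abs_mult[symmetric] mult.assoc)

text \<open>The form is continuous on the compact unit sphere and homogeneous of degree two, so the
  minimum there bounds it everywhere.\<close>

lemma form_minimizer:
  obtains f \<nu> where "(\<Sum>x\<in>S. (f x)\<^sup>2) = 1" "form f f = \<nu>"
    "\<And>g. form g g \<ge> \<nu> * (\<Sum>x\<in>S. (g x)\<^sup>2)"
proof -
  \<comment> \<open>Fixing the value 0 outside \<open>S\<close> makes \<open>B\<close> a product of
    compact sets, compact by Tychonoff even if the vertex type is infinite.\<close>
  define B where "B = PiE UNIV (\<lambda>x. if x \<in> S then {-1..1::real} else {0})"
  define K where "K = B \<inter> {f. (\<Sum>x\<in>S. (f x)\<^sup>2) = 1}"
  have cB: "compact B"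
    unfolding B_def compactin_euclidean_iff[symmetric] euclidean_product_topology[symmetric]
    by (subst compactin_PiE) auto
  have cont: "continuous_on UNIV (\<lambda>f :: 'a \<Rightarrow> real. f x)" for x
    by (rule continuous_on_product_coordinates)
  have "closed {f :: 'a \<Rightarrow> real. (\<Sum>x\<in>S. (f x)\<^sup>2) = 1}"
    by (intro closed_Collect_eq continuous_intros cont)
  then have cK: "compact K"
    unfolding K_def using cB by blast
  obtain z where z: "z \<in> S" using S_nonempty by blast
  have "(\<lambda>x. if x = z then 1 else 0) \<in> K"
    using z finite_S by (auto simp: K_def B_def if_distrib[of "\<lambda>c. c\<^sup>2"] cong: if_cong)
  then have "K \<noteq> {}" by blast
  moreover have "continuous_on K (\<lambda>f. form f f)"
    unfolding form_def lap_def by (intro continuous_intros continuous_on_subset[OF cont]) auto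
  ultimately obtain f where f: "f \<in> K" and min: "\<And>g. g \<in> K \<Longrightarrow> form f f \<le> form g g"
    using continuous_attains_inf[OF cK] by blast
  have "form g g \<ge> form f f * (\<Sum>x\<in>S. (g x)\<^sup>2)" for g
  proof (cases "(\<Sum>x\<in>S. (g x)\<^sup>2) = 0")
    case True
    then have "g x = 0" if "x \<in> S" for x
      using that finite_S by (simp add: sum_nonneg_eq_0_iff)
    then have "form g g = 0" by (simp add: form_def)
    with True show ?thesis by simp
  next
    case False
    define N where "N = sqrt (\<Sum>x\<in>S. (g x)\<^sup>2)"
    have N2: "N\<^sup>2 = (\<Sum>x\<in>S. (g x)\<^sup>2)" by (simp add: N_def sum_nonneg)
    have N: "N > 0" using False by (simp add: N_def sum_nonneg less_le)
    define h where "h x = (if x \<in> S then g x / N else 0)" for x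
    have "(\<Sum>x\<in>S. (h x)\<^sup>2) = 1"
      using N by (simp add: h_def power_divide N2 False flip: sum_divide_distrib)
    moreover have "\<bar>h x\<bar> \<le> 1" if "x \<in> S" for x
    proof -
      have "(h x)\<^sup>2 \<le> (\<Sum>x\<in>S. (h x)\<^sup>2)"
        using that finite_S by (intro member_le_sum) auto
      with calculation show ?thesis by (simp add: abs_square_le_1)
    qed
    moreover have "h x = 0" if "x \<notin> S" for x using that by (simp add: h_def)
    ultimately have "h \<in> K"
      by (force simp: K_def B_def abs_le_iff)
    then have "form f f \<le> form h h" by (rule min)
    moreover have "form h h = form (\<lambda>x. g x / N) (\<lambda>x. g x / N)"
      by (rule form_cong) (simp add: h_def)
    moreover have "\<dots> = form g g / N\<^sup>2"
      by (simp add: form_eq sum_divide_distrib add_divide_distrib diff_divide_distrib power2_eq_square)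
    ultimately show ?thesis using N by (simp add: N2[symmetric] field_simps)
  qed
  with f that[of f "form f f"] show thesis by (auto simp: K_def)
qed

text \<open>The absolute value of a minimiser is again one. Varying it at a single vertex gives the
  eigenvalue equation there, and a zero would spread along edges to all of \<open>S\<close>.\<close>

lemma ex_positive_eigenfunction:
  obtains f \<nu> where "\<And>x. x \<in> S \<Longrightarrow> f x > 0" "\<And>x. x \<in> S \<Longrightarrow> lap f x = \<nu> * f x"
proof -
  obtain f0 \<nu> where f0: "(\<Sum>x\<in>S. (f0 x)\<^sup>2) = 1" "form f0 f0 = \<nu>"
    and min: "\<And>g. form g g \<ge> \<nu> * (\<Sum>x\<in>S. (g x)\<^sup>2)"
    using form_minimizer by metis
  define f where "f x = \<bar>f0 x\<bar>" for x
  have n1: "(\<Sum>x\<in>S. (f x)\<^sup>2) = 1" by (simp add: f_def f0)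
  have ff: "form f f = \<nu>"
    using form_abs_le[of f0] min[of f] n1 f0 unfolding f_def by (auto intro: antisym)
  have eig: "lap f z = \<nu> * f z" if z: "z \<in> S" for z
  proof -
    define \<delta> :: "'a \<Rightarrow> real" where "\<delta> x = (if x = z then 1 else 0)" for x
    define b where "b = lap f z - \<nu> * f z"
    define c where "c = form \<delta> \<delta> - \<nu>"
    have d: "form \<delta> f = lap f z" unfolding \<delta>_def using form_delta[OF z] .
    have "(\<Sum>x\<in>S. (f x + t * \<delta> x)\<^sup>2) = 1 + 2 * t * f z + t\<^sup>2" for t
    proof -
      have "(\<Sum>x\<in>S. (f x + t * \<delta> x)\<^sup>2) = (\<Sum>x\<in>S. (f x)\<^sup>2 + (if x = z then 2 * t * f z + t\<^sup>2 else 0))"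
        by (intro sum.cong) (auto simp: \<delta>_def power2_eq_square algebra_simps)
      then show ?thesis using z finite_S n1 by (simp add: sum.distrib)
    qed
    then have ineq: "2 * b * t + c * t\<^sup>2 \<ge> 0" for t
      using min[of "\<lambda>x. f x + t * \<delta> x"] unfolding form_add_mult ff d b_def c_def
      by (simp add: algebra_simps)
    have "b = 0"
    proof (rule ccontr)
      assume "b \<noteq> 0"
      define C where "C = \<bar>c\<bar> + 1"
      have C: "C > 0" "c < C" by (auto simp: C_def)
      \<comment> \<open>At t = - b / C with C > c the linear term outweighs the quadratic one, so
        the value is at most - b^2 / C < 0.\<close>
      have "2 * b * (- b / C) + c * (- b / C)\<^sup>2 \<ge> 0" by (rule ineq)
      then have "c * (b\<^sup>2 / C\<^sup>2) \<ge> 2 * (b\<^sup>2 / C)" by (simp add: power2_eq_square field_simps)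
      moreover have "c * (b\<^sup>2 / C\<^sup>2) \<le> C * (b\<^sup>2 / C\<^sup>2)" using C by (intro mult_right_mono) auto
      moreover have "C * (b\<^sup>2 / C\<^sup>2) = b\<^sup>2 / C" using C by (simp add: power2_eq_square)
      moreover have "b\<^sup>2 / C > 0" using C \<open>b \<noteq> 0\<close> by simp
      ultimately show False by linarith
    qed
    then show ?thesis by (simp add: b_def)
  qed
  \<comment> \<open>At a zero of \<open>f\<close> the equation says that the nonnegative values at
    the neighbours sum to zero.\<close>
  have nb0: "f y = 0" if "x \<in> S" "f x = 0" "(x, y) \<in> E" for x y
  proof -
    have "(\<Sum>y\<in>E `` {x}. f y) = 0"
      using eig[OF that(1)] that(2) by (simp add: lap_def sum_negf)
    then have "\<forall>y\<in>E `` {x}. f y = 0"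
      by (subst (asm) sum_nonneg_eq_0_iff) (auto simp: f_def)
    with that show ?thesis by auto
  qed
  have pos: "f x > 0" if x: "x \<in> S" for x
  proof (rule ccontr)
    assume "\<not> f x > 0"
    then have x0: "f x = 0" by (simp add: f_def)
    have "f y = 0" if "y \<in> S" for y
      using E_conn[OF x that]
    proof (induction rule: rtrancl_induct)
      case (step y z)
      then show ?case using nb0 E_sub by blast
    qed (rule x0)
    then have "(\<Sum>x\<in>S. (f x)\<^sup>2) = 0" by simp
    with n1 show False by simp
  qed
  from that[OF pos eig] show thesis .
qed

text \<open>Maximum principle: compare the two eigenvalue equations where \<open>g / f\<close> is largest.\<close>

lemma positive_eigenfunction_least:
  assumes pos: "\<And>x. x \<in> S \<Longrightarrow> f x > 0" and eig: "\<And>x. x \<in> S \<Longrightarrow> lap f x = \<nu> * f x"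
    and geig: "\<And>x. x \<in> S \<Longrightarrow> lap g x = \<mu> * g x" and "z \<in> S" "g z \<noteq> 0"
  shows "\<nu> \<le> \<mu>"
proof -
  have main: "\<nu> \<le> \<mu>" if heig: "\<And>x. x \<in> S \<Longrightarrow> lap h x = \<mu> * h x" and "h z > 0" for h
  proof -
    define q where "q x = h x / f x" for x
    have "Max (q ` S) \<in> q ` S" using finite_S S_nonempty by (intro Max_in) auto
    then obtain x where x: "x \<in> S" and "q x = Max (q ` S)" by auto
    then have max: "q y \<le> q x" if "y \<in> S" for y using that finite_S by simp
    have "q z > 0" using \<open>h z > 0\<close> pos[OF \<open>z \<in> S\<close>] by (simp add: q_def)
    then have qx: "q x > 0" using max[OF \<open>z \<in> S\<close>] by simp
    have hx: "h y = q y * f y" if "y \<in> S" for y using pos[OF that] by (simp add: q_def)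
    have "q x * lap f x \<le> lap h x"
    proof -
      have "q x * (f x - f y) \<le> h x - h y" if "y \<in> E `` {x}" for y
      proof -
        have "y \<in> S" using that nb_sub by blast
        then show ?thesis using mult_right_mono[OF max, of y "f y"] pos[of y]
          by (simp add: hx x algebra_simps)
      qed
      then show ?thesis
        by (auto simp: lap_def hx[OF x] sum_distrib_left distrib_left intro!: sum_mono)
    qed
    then have "\<nu> * h x \<le> \<mu> * h x"
      by (simp add: eig[OF x] heig[OF x] hx[OF x] mult_ac)
    moreover have "h x > 0" using hx[OF x] qx pos[OF x] by simp
    ultimately show ?thesis by simp
  qed
  show ?thesis
  proof (cases "g z > 0")
    case False
    then have "- g z > 0" using \<open>g z \<noteq> 0\<close> by simp
    moreover have "lap (\<lambda>x. - g x) x = \<mu> * - g x" if "x \<in> S" for x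
      using geig[OF that] by (simp add: lap_def sum_subtractf sum_negf)
    ultimately show ?thesis using main[of "\<lambda>x. - g x"] by blast
  qed (use main[of g] geig in blast)
qed

end

section \<open>Edge cuts in trees\<close>

text \<open>A connected graph on n vertices has at least n - 1 edges, each counted as two arcs: a
  set grown from \<open>r\<close> one vertex at a time gains an edge at every step.\<close>

lemma card_connected_arcs:
  assumes "finite C" "F \<subseteq> C \<times> C" "sym F" "r \<in> C" "\<And>z. z \<in> C \<Longrightarrow> (r, z) \<in> F\<^sup>*"
  shows "2 * card C \<le> card F + 2"
proof -
  have fF: "finite F" using assms(1,2) finite_subset by blast
  have grow: "n < card C \<Longrightarrow> \<exists>X \<subseteq> C. r \<in> X \<and> card X = Suc n \<and> 2 * n \<le> card (F \<inter> X \<times> X)" for n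
  proof (induction n)
    case 0
    show ?case by (rule exI[of _ "{r}"]) (use assms in auto)
  next
    case (Suc n)
    then obtain X where X: "X \<subseteq> C" "r \<in> X" "card X = Suc n" "2 * n \<le> card (F \<inter> X \<times> X)"
      by auto
    have "\<exists>u v. (u, v) \<in> F \<and> u \<in> X \<and> v \<notin> X"
    proof (rule ccontr)
      assume a: "\<nexists>u v. (u, v) \<in> F \<and> u \<in> X \<and> v \<notin> X"
      have "z \<in> X" if "z \<in> C" for z
        using assms(5)[OF that] by (induction rule: rtrancl_induct) (use a X in auto)
      then have "C \<subseteq> X" by blast
      with X have "C = X" by blast
      with X Suc.prems show False by simp
    qed
    then obtain u v where uv: "(u, v) \<in> F" "u \<in> X" "v \<notin> X" by blast
    have "F \<inter> X \<times> X \<union> {(u, v), (v, u)} \<subseteq> F \<inter> insert v X \<times> insert v X"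
      using uv assms(3) by (auto dest: symD)
    then have "card (F \<inter> X \<times> X \<union> {(u, v), (v, u)}) \<le> card (F \<inter> insert v X \<times> insert v X)"
      using fF by (intro card_mono) auto
    moreover have "card (F \<inter> X \<times> X \<union> {(u, v), (v, u)}) = card (F \<inter> X \<times> X) + card {(u, v), (v, u)}"
      using fF uv by (intro card_Un_disjoint) auto
    moreover have "u \<noteq> v" using uv by blast
    then have "card {(u, v), (v, u)} = 2" by simp
    moreover have "finite X" using X(1) assms(1) finite_subset by blast
    ultimately show ?case
      using X uv assms(2) by (intro exI[of _ "insert v X"]) auto
  qed
  have "card C > 0" using assms(1,4) by (auto simp: card_gt_0_iff)
  then obtain X where "2 * (card C - 1) \<le> card (F \<inter> X \<times> X)"
    using grow[of "card C - 1"] by auto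
  also have "\<dots> \<le> card F" using fF by (intro card_mono) auto
  finally show ?thesis by simp
qed

text \<open>Acyclicity in the form used for cuts: deleting an edge xy leaves the two components
  \<open>side x y\<close> and \<open>side y x\<close>.\<close>

locale weighted_tree = weighted_graph +
  assumes bridge: "(x, y) \<in> E \<Longrightarrow> (x, y) \<notin> (E - {(x, y), (y, x)})\<^sup>*"
begin

definition side :: "'a \<Rightarrow> 'a \<Rightarrow> 'a set" where
  "side x y = {z. (x, z) \<in> (E - {(x, y), (y, x)})\<^sup>*}"

lemma irrefl: "(x, x) \<notin> E"
  using bridge[of x x] by auto

lemma side_self [simp]: "x \<in> side x y"
  by (simp add: side_def)

lemma side_other: "(x, y) \<in> E \<Longrightarrow> y \<notin> side x y"
  using bridge by (simp add: side_def)

lemma side_step: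
  assumes "(x, y) \<in> E" "z \<in> side x y" "(z, z') \<in> E" "z' \<notin> side x y"
  shows "z = x \<and> z' = y"
proof -
  have "(x, z) \<in> (E - {(x, y), (y, x)})\<^sup>*" using assms(2) by (simp only: side_def mem_Collect_eq)
  have *: "(x, z') \<notin> (E - {(x, y), (y, x)})\<^sup>*" using assms(4) by (simp only: side_def mem_Collect_eq not_False_eq_True)
  have "(z, z') \<notin> E - {(x, y), (y, x)}"
    using rtrancl_into_rtrancl[OF \<open>(x, z) \<in> _\<close>] * by (rule contrapos_nn[rotated])
  with assms(3) have "(z, z') = (x, y) \<or> (z, z') = (y, x)" by blast
  with assms(2) side_other[OF assms(1)] show ?thesis by auto
qed

lemma side_disjoint:
  assumes "(x, y) \<in> E"
  shows "side x y \<inter> side y x = {}"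
proof -
  define R where "R = (E - {(x, y), (y, x)})\<^sup>*"
  have swap: "{(y, x), (x, y)} = {(x, y), (y, x)}" by blast
  have "sym (E - {(x, y), (y, x)})" using E_symD by (auto intro!: symI)
  then have "sym R" unfolding R_def by (rule sym_rtrancl)
  have False if "z \<in> side x y" "z \<in> side y x" for z
  proof -
    have "(x, z) \<in> R" "(y, z) \<in> R"
      using that unfolding side_def R_def swap by simp_all
    then have "(x, y) \<in> R"
      using symD[OF \<open>sym R\<close>] unfolding R_def by (meson rtrancl_trans)
    then show False using bridge[OF assms] unfolding R_def by contradiction
  qed
  then show ?thesis by blast
qed

lemma side_Un:
  assumes "(x, y) \<in> E"
  shows "side x y \<union> side y x = S"
proof (intro equalityI subsetI)
  fix z assume "z \<in> side x y \<union> side y x"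
  then have "(x, z) \<in> E\<^sup>* \<or> (y, z) \<in> E\<^sup>*"
    unfolding side_def using rtrancl_mono[of "E - _" E] by blast
  moreover have "x \<in> S" "y \<in> S" using assms E_sub by auto
  moreover have "E\<^sup>* `` S = S" using E_sub by (intro Image_closed_trancl) blast
  ultimately show "z \<in> S" by blast
next
  fix z assume z: "z \<in> S"
  have "x \<in> S" using assms E_sub by auto
  from E_conn[OF this z] show "z \<in> side x y \<union> side y x"
  proof (induction rule: rtrancl_induct)
    case (step z z')
    show ?case
      using step.IH side_step[OF assms _ step.hyps(2)] side_step[OF E_symD[OF assms] _ step.hyps(2)]
      by (metis UnCI UnE side_self)
  qed auto
qed

lemma side_sub: "(x, y) \<in> E \<Longrightarrow> side x y \<subseteq> S"
  using side_Un by blast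

lemma finite_side: "(x, y) \<in> E \<Longrightarrow> finite (side x y)"
  using side_sub finite_S finite_subset by blast

lemma side_arcs:
  assumes "(x, y) \<in> E"
  shows "2 * card (side x y) \<le> card (E \<inter> side x y \<times> side x y) + 2"
proof (rule card_connected_arcs)
  show "sym (E \<inter> side x y \<times> side x y)" using E_symD by (auto intro!: symI)
  fix z assume "z \<in> side x y"
  then have "(x, z) \<in> (E - {(x, y), (y, x)})\<^sup>*" by (simp add: side_def)
  then show "(x, z) \<in> (E \<inter> side x y \<times> side x y)\<^sup>*"
  proof (induction rule: rtrancl_induct)
    case (step z z')
    from step.hyps have "z \<in> side x y" "z' \<in> side x y"
      unfolding side_def by (auto intro: rtrancl_into_rtrancl)
    with step show ?case by (auto intro: rtrancl_into_rtrancl)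
  qed simp
qed (use assms finite_side in auto)

lemma E_arcs: "2 * card S \<le> card E + 2"
proof -
  obtain r where "r \<in> S" using S_nonempty by blast
  then show ?thesis using card_connected_arcs[OF finite_S E_sub E_sym] E_conn by blast
qed

text \<open>A walk can leave \<open>side x2 y2\<close> only from \<open>x2\<close>, which lies on
  the other side of the first cut and is never met inside \<open>side y1 x1\<close>.\<close>

lemma side_subset:
  assumes "(x1, y1) \<in> E" "(x2, y2) \<in> E" "x2 \<in> side x1 y1" "y2 \<in> side x1 y1" "y1 \<in> side x2 y2"
  shows "side y1 x1 \<subseteq> side x2 y2"
proof
  fix z assume "z \<in> side y1 x1"
  then have "(y1, z) \<in> (E - {(y1, x1), (x1, y1)})\<^sup>*" by (simp add: side_def)
  then have "z \<in> side x2 y2 \<and> z \<in> side y1 x1"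
  proof (induction rule: rtrancl_induct)
    case (step z z')
    then have "z' \<in> side y1 x1" unfolding side_def by (auto intro: rtrancl_into_rtrancl)
    moreover have "z \<noteq> x2" using step.IH assms(3) side_disjoint[OF assms(1)] by blast
    ultimately show ?case
      using step side_step[OF assms(2), of z z'] by blast
  qed (use assms in auto)
  then show "z \<in> side x2 y2" by blast
qed

lemma edge_same_side:
  assumes "(x1, y1) \<in> E" "(x2, y2) \<in> E" "{x1, y1} \<noteq> {x2, y2}"
  shows "{x2, y2} \<subseteq> side x1 y1 \<or> {x2, y2} \<subseteq> side y1 x1"
proof -
  have "x2 \<in> S" "y2 \<in> S" using assms E_sub by auto
  then show ?thesis
    using side_step[OF assms(1), of x2 y2] side_step[OF E_symD[OF assms(1)], of x2 y2] assms
      side_Un[OF assms(1)] by blast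
qed

text \<open>Orients two distinct edges so that \<open>u1\<close>, \<open>u2\<close> are the inner
  ends. Then \<open>side v1 u1\<close> and \<open>side v2 u2\<close> are the outer parts.\<close>

lemma edges_facing_away:
  assumes "(x1, y1) \<in> E" "(x2, y2) \<in> E" "{x1, y1} \<noteq> {x2, y2}"
  obtains u1 v1 u2 v2 where "(u1, v1) \<in> {(x1, y1), (y1, x1)}" "(u2, v2) \<in> {(x2, y2), (y2, x2)}"
    "{u2, v2} \<subseteq> side u1 v1" "{u1, v1} \<subseteq> side u2 v2"
proof -
  from edge_same_side[OF assms] obtain u1 v1 where 1: "(u1, v1) \<in> {(x1, y1), (y1, x1)}"
    "{x2, y2} \<subseteq> side u1 v1" by blast
  have "{x2, y2} \<noteq> {x1, y1}" using assms(3) by blast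
  from edge_same_side[OF assms(2,1) this] obtain u2 v2 where 2: "(u2, v2) \<in> {(x2, y2), (y2, x2)}"
    "{x1, y1} \<subseteq> side u2 v2" by blast
  have "{u1, v1} = {x1, y1}" "{u2, v2} = {x2, y2}" using 1 2 by blast+
  then show thesis using that 1 2 by metis
qed

end

section \<open>The function r + 1/r - 2 of a ratio of positive values\<close>

lemma ratio_energy_ge:
  fixes a b \<mu> :: real
  assumes "a > 0" "b > 0" "0 < \<mu>" "\<mu> < 1" "b / a \<le> 1 - \<mu>"
  shows "\<mu>\<^sup>2 / (1 - \<mu>) \<le> b / a + a / b - 2"
proof -
  define r where "r = b / a"
  have r: "r > 0" "r \<le> 1 - \<mu>" using assms by (auto simp: r_def)
  \<comment> \<open>r + 1/r - 2 = (1 - r)^2 / r decreases on (0, 1) and equals \<mu>^2 / (1 - \<mu>)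
    at r = 1 - \<mu>.\<close>
  have "\<mu>\<^sup>2 / (1 - \<mu>) \<le> (1 - r)\<^sup>2 / (1 - \<mu>)"
    using assms r by (intro divide_right_mono power_mono) auto
  also have "\<dots> \<le> (1 - r)\<^sup>2 / r"
    using assms r by (intro divide_left_mono) auto
  also have "\<dots> = r + 1 / r - 2" using r by (simp add: power2_eq_square field_simps)
  also have "1 / r = a / b" by (simp add: r_def)
  finally show ?thesis by (simp add: r_def)
qed

text \<open>Clearing denominators gives a quadratic in r = b / a with roots 1 - \<mu> and 1 / (1 -
  \<mu>).\<close>

lemma ratio_energy_eq:
  fixes a b \<mu> :: real
  assumes "a > 0" "b > 0" "0 < \<mu>" "\<mu> < 1" "b / a + a / b - 2 = \<mu>\<^sup>2 / (1 - \<mu>)"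
  shows "b / a = 1 - \<mu> \<or> a / b = 1 - \<mu>"
proof -
  define r where "r = b / a"
  have r: "r > 0" "a / b = 1 / r" using assms by (auto simp: r_def)
  have "r + 1 / r - 2 = \<mu>\<^sup>2 / (1 - \<mu>)" using assms(5) unfolding r(2) r_def[symmetric] .
  then have "(1 - \<mu>) * (r\<^sup>2 + 1 - 2 * r) = \<mu>\<^sup>2 * r"
    using r assms by (simp add: field_simps power2_eq_square)
  then have "(r - (1 - \<mu>)) * ((1 - \<mu>) * r - 1) = 0"
    by (simp add: power2_eq_square algebra_simps)
  then have "r = 1 - \<mu> \<or> (1 - \<mu>) * r = 1" by auto
  then have "r = 1 - \<mu> \<or> 1 / r = 1 - \<mu>" using r by (auto simp: field_simps)
  then show ?thesis unfolding r(2) r_def[symmetric] .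
qed

lemma ratio_energy_zero:
  fixes a b :: real
  assumes "a > 0" "b > 0" "b / a + a / b - 2 = 0"
  shows "a = b"
proof -
  have "(a - b)\<^sup>2 = a * b * (b / a + a / b - 2)"
    using assms by (simp add: field_simps power2_eq_square)
  then show ?thesis using assms by simp
qed

lemma ratio_energy_nonneg:
  fixes a b :: real
  assumes "a > 0" "b > 0"
  shows "0 \<le> b / a + a / b - 2"
proof -
  have "b / a + a / b - 2 = (a - b)\<^sup>2 / (a * b)"
    using assms by (simp add: field_simps power2_eq_square)
  then show ?thesis using assms by simp
qed

section \<open>Ratios of the ground state along edges\<close>

text \<open>The assumption \<mu> \<le> \<nu> opposes the bound to be proved, so the locale covers a
  counterexample and the equality case together; it leads to \<nu> = \<mu>. As the roots of the
  quadratic have product 1, \<mu> < 1 selects the smaller one.\<close>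

locale eigen_tree = weighted_tree S E "\<lambda>x. real_of_int (m x)"
  for S :: "'a set" and E m +
  fixes f :: "'a \<Rightarrow> real" and \<nu> \<mu> :: real and h :: nat
  assumes f_pos: "x \<in> S \<Longrightarrow> f x > 0"
    and eigen: "x \<in> S \<Longrightarrow> lap f x = \<nu> * f x"
    and card_S: "card S = 2 * h" and h_ge: "h \<ge> 2"
    and sum_m: "(\<Sum>x\<in>S. m x) = 2"
    and mu_eq: "\<mu>\<^sup>2 - (real h + 1) * \<mu> + 1 = 0" and mu_pos: "0 < \<mu>" and mu_less: "\<mu> < 1"
    and nu_ge: "\<mu> \<le> \<nu>"
begin

text \<open>The summand is (f x - f y)^2 / (f x * f y). The sum runs over arcs and meets each edge
  twice, hence the division by 2.\<close>

definition energy :: "'a set \<Rightarrow> real" where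
  "energy C = (\<Sum>(x, y)\<in>E \<inter> C \<times> C. f y / f x + f x / f y - 2) / 2"

definition charge :: "'a set \<Rightarrow> int" where
  "charge C = (\<Sum>x\<in>C. m x)"

definition \<tau> :: real where "\<tau> = \<mu>\<^sup>2 / (1 - \<mu>)"

lemma tau_pos: "\<tau> > 0"
  using mu_pos mu_less by (simp add: \<tau>_def)

text \<open>The balance of a star with \<open>h\<close> vertices and charge 1: each vertex costs
  \<mu> and each of the h - 1 edges costs \<tau>. Multiplied by 1 - \<mu> it is the quadratic
  equation of \<mu>.\<close>

lemma tau_eq: "real h * \<mu> + (real h - 1) * \<tau> = 1"
proof -
  have t: "(1 - \<mu>) * \<tau> = \<mu>\<^sup>2" using mu_less by (simp add: \<tau>_def)
  have "(1 - \<mu>) * (real h * \<mu> + (real h - 1) * \<tau>) = real h * \<mu> * (1 - \<mu>) + (real h - 1) * ((1 - \<mu>) * \<tau>)"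
    by (simp add: algebra_simps)
  also have "\<dots> = (1 - \<mu>) * 1"
    unfolding t using mu_eq by (simp add: power2_eq_square algebra_simps)
  finally have "(1 - \<mu>) * (real h * \<mu> + (real h - 1) * \<tau>) = (1 - \<mu>) * 1" .
  then show ?thesis using mu_less by (metis less_irrefl mult_cancel_left right_minus_eq)
qed

lemma E_f_pos: "(x, y) \<in> E \<Longrightarrow> f x > 0" "(x, y) \<in> E \<Longrightarrow> f y > 0"
  using E_sub f_pos by auto

lemma sum_arcs: "C \<subseteq> S \<Longrightarrow> (\<Sum>x\<in>C. \<Sum>y\<in>E `` {x} \<inter> D. g x y) = (\<Sum>(x, y)\<in>E \<inter> C \<times> D. g x y)"
  by (subst sum.Sigma) (auto intro!: sum.cong finite_subset[OF _ finite_S] simp: finite_E)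

text \<open>Divide the eigenvalue equation at each vertex by \<open>f\<close> there and add up over \<open>C\<close>.\<close>

lemma balance:
  assumes C: "C \<subseteq> S"
  shows "(\<Sum>(x, y)\<in>E \<inter> C \<times> - C. 1 - f y / f x) + charge C - energy C = \<nu> * card C"
proof -
  have fC: "finite C" using C finite_S finite_subset by blast
  have "(\<Sum>y\<in>E `` {x}. 1 - f y / f x) + m x = \<nu>" if "x \<in> C" for x
  proof -
    have x: "x \<in> S" "f x > 0" using C that f_pos by auto
    have "(\<Sum>y\<in>E `` {x}. 1 - f y / f x) = (\<Sum>y\<in>E `` {x}. f x - f y) / f x"
      unfolding sum_divide_distrib using x by (intro sum.cong) (auto simp: field_simps)
    also have "(\<Sum>y\<in>E `` {x}. f x - f y) = (\<nu> - m x) * f x"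
      using eigen[OF x(1)] by (simp add: lap_def algebra_simps)
    finally show ?thesis using x by simp
  qed
  then have "(\<Sum>x\<in>C. (\<Sum>y\<in>E `` {x}. 1 - f y / f x) + m x) = \<nu> * card C"
    by simp
  moreover have "(\<Sum>y\<in>E `` {x}. 1 - f y / f x)
      = (\<Sum>y\<in>E `` {x} \<inter> C. 1 - f y / f x) + (\<Sum>y\<in>E `` {x} \<inter> - C. 1 - f y / f x)" for x
    by (subst sum.union_disjoint[symmetric]) (auto intro!: sum.cong)
  ultimately have "(\<Sum>x\<in>C. \<Sum>y\<in>E `` {x} \<inter> C. 1 - f y / f x)
      + (\<Sum>(x, y)\<in>E \<inter> C \<times> - C. 1 - f y / f x) + charge C = \<nu> * card C"
    by (simp add: sum.distrib sum_arcs[OF C] charge_def)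
  moreover have "2 * (\<Sum>x\<in>C. \<Sum>y\<in>E `` {x} \<inter> C. 1 - f y / f x) = - 2 * energy C"
  proof -
    have "2 * (\<Sum>x\<in>C. \<Sum>y\<in>E `` {x} \<inter> C. 1 - f y / f x)
        = (\<Sum>x\<in>C. \<Sum>y\<in>E `` {x} \<inter> C. 1 - f y / f x) + (\<Sum>x\<in>C. \<Sum>y\<in>E `` {x} \<inter> C. 1 - f x / f y)"
      using sum_nb_swap[OF C, of "\<lambda>x y. 1 - f y / f x"] by simp
    also have "\<dots> = - (\<Sum>x\<in>C. \<Sum>y\<in>E `` {x} \<inter> C. f y / f x + f x / f y - 2)"
      by (simp add: sum_negf[symmetric] algebra_simps flip: sum.distrib)
    also have "\<dots> = - 2 * energy C"
      by (simp add: sum_arcs[OF C] energy_def)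
    finally show ?thesis .
  qed
  ultimately show ?thesis by simp
qed

lemma charge_S: "charge S = 2"
  by (simp add: charge_def sum_m)

lemma balance_S: "energy S = 2 - \<nu> * (2 * real h)"
proof -
  have "E \<inter> S \<times> - S = {}" using E_sub by blast
  with balance[of S] show ?thesis by (simp add: charge_S card_S)
qed

text \<open>The cut edge is the only arc leaving its side, so the balance has a single boundary
  term.\<close>

lemma balance_side:
  assumes "(x, y) \<in> E"
  shows "1 - f y / f x = \<nu> * card (side x y) - charge (side x y) + energy (side x y)"
proof -
  have "E \<inter> side x y \<times> - side x y = {(x, y)}"
    using side_step[OF assms] side_other[OF assms] assms by auto
  with balance[OF side_sub[OF assms]] show ?thesis by simp
qed

lemma charge_sides:
  assumes "(x, y) \<in> E"
  shows "charge (side x y) + charge (side y x) = 2"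
  unfolding charge_S[symmetric] charge_def side_Un[OF assms, symmetric]
  using side_disjoint[OF assms] finite_side[OF assms] finite_side[OF E_symD[OF assms]]
  by (rule sum.union_disjoint[symmetric, rotated 2])

lemma card_sides:
  assumes "(x, y) \<in> E"
  shows "card (side x y) + card (side y x) = 2 * h"
  unfolding card_S[symmetric] side_Un[OF assms, symmetric]
  using side_disjoint[OF assms] finite_side[OF assms] finite_side[OF E_symD[OF assms]]
  by (rule card_Un_disjoint[symmetric, rotated 2])

section \<open>Bad edges: at most one exists\<close>

definition bad :: "'a rel" where
  "bad = {(x, y) \<in> E. 1 - \<mu> < f y / f x \<and> 1 - \<mu> < f x / f y}"

lemma bad_sym: "(x, y) \<in> bad \<Longrightarrow> (y, x) \<in> bad"
  using E_symD by (auto simp: bad_def)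

lemma bad_E: "(x, y) \<in> bad \<Longrightarrow> (x, y) \<in> E"
  by (auto simp: bad_def)

lemma energy_term_nonneg: "(x, y) \<in> E \<Longrightarrow> 0 \<le> f y / f x + f x / f y - 2"
  using E_f_pos ratio_energy_nonneg by blast

lemma energy_nonneg: "energy C \<ge> 0"
  unfolding energy_def using energy_term_nonneg by (auto intro!: sum_nonneg)

lemma not_bad_energy:
  assumes "(x, y) \<in> E - bad"
  shows "\<tau> \<le> f y / f x + f x / f y - 2"
proof -
  have "f x > 0" "f y > 0" using assms E_f_pos by auto
  moreover have "f y / f x \<le> 1 - \<mu> \<or> f x / f y \<le> 1 - \<mu>"
    using assms by (auto simp: bad_def)
  ultimately show ?thesis
    using ratio_energy_ge[of "f x" "f y" \<mu>] ratio_energy_ge[of "f y" "f x" \<mu>] mu_pos mu_less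
    by (auto simp: \<tau>_def add.commute)
qed

lemma energy_ge:
  "\<tau> * card (E \<inter> C \<times> C - bad) \<le> 2 * energy C"
proof -
  have "\<tau> * card (E \<inter> C \<times> C - bad) = (\<Sum>(x, y)\<in>E \<inter> C \<times> C - bad. \<tau>)" by simp
  also have "\<dots> \<le> (\<Sum>(x, y)\<in>E \<inter> C \<times> C - bad. f y / f x + f x / f y - 2)"
    using not_bad_energy by (intro sum_mono) auto
  also have "\<dots> \<le> (\<Sum>(x, y)\<in>E \<inter> C \<times> C. f y / f x + f x / f y - 2)"
    using energy_term_nonneg by (intro sum_mono2) (auto simp: finite_E)
  finally show ?thesis by (simp add: energy_def)
qed

text \<open>A side with n vertices is connected, so it has at least n - 1 edges, here all of energy
  at least \<tau>.\<close>

lemma energy_side_ge: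
  assumes "(x, y) \<in> E" "bad \<inter> side x y \<times> side x y = {}"
  shows "\<tau> * (real (card (side x y)) - 1) \<le> energy (side x y)"
proof -
  have "E \<inter> side x y \<times> side x y - bad = E \<inter> side x y \<times> side x y" using assms by blast
  then have "2 * \<tau> * (real (card (side x y)) - 1) \<le> \<tau> * card (E \<inter> side x y \<times> side x y - bad)"
    using side_arcs[OF assms(1)] tau_pos by simp
  with energy_ge[of "side x y"] show ?thesis by simp
qed

lemma card_side_pos: "(x, y) \<in> E \<Longrightarrow> card (side x y) \<ge> 1"
  using finite_side side_self by (metis One_nat_def Suc_leI card_gt_0_iff empty_iff)

text \<open>With charge at most 0 the balance of the side would give 1 - f y / f x \<ge> \<nu> \<ge>
  \<mu>, so the edge would not be bad. Both sides thus have positive integer charge, and the two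
  charges sum to 2.\<close>

lemma bad_charge:
  assumes "(x, y) \<in> bad"
  shows "charge (side x y) = 1"
proof -
  have pos: "charge (side x y) \<ge> 1" if b: "(x, y) \<in> bad" for x y
  proof (rule ccontr)
    assume "\<not> ?thesis"
    then have "real_of_int (charge (side x y)) \<le> 0" by simp
    moreover have "\<nu> * 1 \<le> \<nu> * card (side x y)"
      using nu_ge mu_pos card_side_pos[OF bad_E[OF b]] by (intro mult_left_mono) auto
    ultimately have "\<mu> \<le> 1 - f y / f x"
      using balance_side[OF bad_E[OF b]] energy_nonneg[of "side x y"] nu_ge by linarith
    with b show False by (auto simp: bad_def)
  qed
  show ?thesis
    using pos[OF assms] pos[OF bad_sym[OF assms]] charge_sides[OF bad_E[OF assms]] by linarith
qed

text \<open>The vertices between the two edges carry no total charge, so a second vertex there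
  would leave no room for both ratios to exceed \<open>1 - \<mu>\<close>.\<close>

lemma bad_pair:
  assumes b: "(x1, y1) \<in> bad" "(x2, y2) \<in> bad"
    and away: "{x2, y2} \<subseteq> side x1 y1" "{x1, y1} \<subseteq> side x2 y2"
  shows "x1 = x2" "(1 - f y1 / f x1) + (1 - f y2 / f x2) = \<nu>"
    "card (side y1 x1) + card (side y2 x2) = 2 * h - 1"
proof -
  note e1 = bad_E[OF b(1)] and e2 = bad_E[OF b(2)]
  note e1' = E_symD[OF e1] and e2' = E_symD[OF e2]
  define B1 where "B1 = side y1 x1"
  define B2 where "B2 = side y2 x2"
  define C where "C = S - (B1 \<union> B2)"
  have B1S: "B1 \<subseteq> S" "finite B1" and B2S: "B2 \<subseteq> S" "finite B2"
    using side_sub[OF e1'] side_sub[OF e2'] finite_side[OF e1'] finite_side[OF e2']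
    by (auto simp: B1_def B2_def)
  \<comment> \<open>The outer parts are disjoint, so \<open>S\<close> splits into \<open>B1\<close>,
    \<open>B2\<close> and the middle part \<open>C\<close>, which only the two given arcs
    leave.\<close>
  have "B1 \<subseteq> side x2 y2" unfolding B1_def using away e1 e2 by (intro side_subset) auto
  then have disj: "B1 \<inter> B2 = {}" using side_disjoint[OF e2] by (auto simp: B2_def)
  have x1: "x1 \<in> C"
    using away side_disjoint[OF e1] side_disjoint[OF e2] e1 E_sub side_self[of x1 y1]
    by (auto simp: C_def B1_def B2_def simp del: side_self)
  have x2: "x2 \<in> C"
    using away side_disjoint[OF e1] side_disjoint[OF e2] e2 E_sub side_self[of x2 y2]
    by (auto simp: C_def B1_def B2_def simp del: side_self)
  have y: "y1 \<in> B1" "y2 \<in> B2" by (auto simp: B1_def B2_def)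
  have "E \<inter> C \<times> - C = {(x1, y1), (x2, y2)}"
  proof (intro equalityI subrelI)
    fix u v assume uv: "(u, v) \<in> E \<inter> C \<times> - C"
    then have "v \<in> B1 \<union> B2" using E_sub by (auto simp: C_def)
    then show "(u, v) \<in> {(x1, y1), (x2, y2)}"
      using uv side_step[OF e1', of v u] side_step[OF e2', of v u] E_symD[of u v]
      by (auto simp: C_def B1_def B2_def)
  qed (use x1 x2 y e1 e2 in \<open>auto simp: C_def\<close>)
  moreover have "(x1, y1) \<noteq> (x2, y2)" using y disj by auto
  moreover have "charge C = 0"
  proof -
    have "charge S = charge C + charge B1 + charge B2"
      unfolding charge_def C_def using disj B1S B2S finite_S
      by (simp add: sum_diff sum.union_disjoint)
    then show ?thesis using bad_charge[OF bad_sym[OF b(1)]] bad_charge[OF bad_sym[OF b(2)]]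
      by (simp add: charge_S B1_def B2_def)
  qed
  ultimately have bal: "(1 - f y1 / f x1) + (1 - f y2 / f x2) - energy C = \<nu> * card C"
    using balance[of C] by (simp add: C_def)
  have fC: "finite C" using finite_S by (simp add: C_def)
  have lt: "1 - f y1 / f x1 < \<mu>" "1 - f y2 / f x2 < \<mu>" using b by (auto simp: bad_def)
  have "\<not> card C \<ge> 2"
  proof
    assume "card C \<ge> 2"
    then have "\<nu> * 2 \<le> \<nu> * card C" using nu_ge mu_pos by (intro mult_left_mono) auto
    then show False using bal lt nu_ge energy_nonneg[of C] by linarith
  qed
  moreover have "card C > 0" using x1 fC by (auto simp: card_gt_0_iff)
  ultimately have C1: "card C = 1" by linarith
  then have C: "C = {x1}" using x1 by (auto simp: card_1_singleton_iff)
  then show "x1 = x2" using x2 by simp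
  have "energy C = 0" using irrefl by (auto simp: energy_def C)
  then show "(1 - f y1 / f x1) + (1 - f y2 / f x2) = \<nu>" using bal C1 by simp
  have "card S = card C + (card B1 + card B2)"
    unfolding C_def using disj B1S B2S finite_S
    by (simp add: card_Diff_subset card_Un_disjoint[symmetric] card_mono)
  then show "card (side y1 x1) + card (side y2 x2) = 2 * h - 1"
    using C1 by (simp add: card_S B1_def B2_def)
qed

text \<open>Two distinct bad edges have the same inner end by \<open>bad_pair\<close>. So no further
  bad edge can hide in an outer part.\<close>

lemma bad_meet:
  assumes b: "(x1, y1) \<in> bad" "(x2, y2) \<in> bad"
  shows "{x1, y1} \<inter> {x2, y2} \<noteq> {}"
proof (cases "{x1, y1} = {x2, y2}")
  case False
  from edges_facing_away[OF bad_E[OF b(1)] bad_E[OF b(2)] False]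
  obtain u1 v1 u2 v2 where *: "(u1, v1) \<in> {(x1, y1), (y1, x1)}" "(u2, v2) \<in> {(x2, y2), (y2, x2)}"
    "{u2, v2} \<subseteq> side u1 v1" "{u1, v1} \<subseteq> side u2 v2" by metis
  then have "(u1, v1) \<in> bad" "(u2, v2) \<in> bad" using b bad_sym by auto
  from bad_pair(1)[OF this *(3,4)] show ?thesis using * by blast
qed simp

text \<open>The edges beyond the first cut all have energy at least \<open>\<tau>\<close>, which forces \<open>f y1 \<ge> f x1\<close>;
  then the second edge alone must account for the whole eigenvalue.\<close>

lemma bad_pair_False:
  assumes b: "(x1, y1) \<in> bad" "(x2, y2) \<in> bad"
    and away: "{x2, y2} \<subseteq> side x1 y1" "{x1, y1} \<subseteq> side x2 y2"
    and card: "card (side y1 x1) \<ge> h"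
  shows False
proof -
  note e1' = E_symD[OF bad_E[OF b(1)]]
  \<comment> \<open>A bad edge in the outer part would have to meet the second bad edge, which lies
    across the cut.\<close>
  have "bad \<inter> side y1 x1 \<times> side y1 x1 = {}"
    using bad_meet[OF _ b(2)] away(1) side_disjoint[OF e1'] by blast
  from energy_side_ge[OF e1' this]
  have "\<tau> * (real (card (side y1 x1)) - 1) \<le> energy (side y1 x1)" .
  moreover have "\<tau> * (real h - 1) \<le> \<tau> * (real (card (side y1 x1)) - 1)"
    using tau_pos card by simp
  moreover have "\<mu> * real h \<le> \<nu> * real (card (side y1 x1))"
    using nu_ge mu_pos card by (intro mult_mono) auto
  ultimately have "1 - f x1 / f y1 \<ge> 0"
    using balance_side[OF e1'] bad_charge[OF bad_sym[OF b(1)]] tau_eq by (simp add: mult.commute)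
  then have "1 - f y1 / f x1 \<le> 0"
    using E_f_pos[OF e1'] by (simp add: field_simps)
  then have "1 - f y2 / f x2 \<ge> \<mu>"
    using bad_pair(2)[OF b away] nu_ge by linarith
  with b show False by (auto simp: bad_def)
qed

lemma bad_unique:
  assumes b: "(x1, y1) \<in> bad" "(x2, y2) \<in> bad"
  shows "(x2, y2) = (x1, y1) \<or> (x2, y2) = (y1, x1)"
proof (cases "{x1, y1} = {x2, y2}")
  case False
  from edges_facing_away[OF bad_E[OF b(1)] bad_E[OF b(2)] False]
  obtain u1 v1 u2 v2 where *: "(u1, v1) \<in> {(x1, y1), (y1, x1)}" "(u2, v2) \<in> {(x2, y2), (y2, x2)}"
    "{u2, v2} \<subseteq> side u1 v1" "{u1, v1} \<subseteq> side u2 v2" by metis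
  then have bb: "(u1, v1) \<in> bad" "(u2, v2) \<in> bad" using b bad_sym by auto
  \<comment> \<open>The outer parts together have 2h - 1 vertices, so they cannot both have fewer
    than \<open>h\<close>.\<close>
  have "card (side v1 u1) \<ge> h \<or> card (side v2 u2) \<ge> h"
    using bad_pair(3)[OF bb *(3,4)] h_ge by linarith
  then show ?thesis
    using bad_pair_False[OF bb *(3,4)] bad_pair_False[OF bb(2,1) *(4,3)] by blast
qed (auto simp: doubleton_eq_iff)

lemma card_bad: "card bad \<le> 2"
proof (cases "bad = {}")
  case False
  then obtain x y where "(x, y) \<in> bad" by auto
  from bad_unique[OF this] have "bad \<subseteq> {(x, y), (y, x)}" by auto
  from card_mono[OF _ this] show ?thesis by (auto simp: card_insert_if split: if_splits)
qed simp

lemma E_arcs_h: "4 * h \<le> card E + 2"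
  using E_arcs by (simp add: card_S)

lemma finite_bad: "finite bad"
  using finite_E finite_subset[of bad E] by (auto simp: bad_def)

lemma card_not_bad: "card (E - bad) + card bad = card E"
  using finite_E finite_bad by (subst card_Diff_subset) (auto simp: bad_def intro!: le_add_diff_inverse2 card_mono)

text \<open>Of at least 4h - 2 arcs at most two are bad, so the total energy 2 - 2 h \<nu> is at
  least (2h - 2) \<tau>. By \<open>tau_eq\<close> this means \<nu> \<le> \<mu>.\<close>

lemma eigenvalue_eq: "\<nu> = \<mu>"
proof -
  have "real (4 * h) \<le> real (card (E - bad) + 4)"
    using E_arcs_h card_bad card_not_bad by linarith
  then have "\<tau> * (4 * real h - 4) \<le> \<tau> * card (E - bad)"
    using tau_pos by simp
  also have "\<dots> \<le> 2 * energy S"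
    using energy_ge[of S] E_sub by (simp add: Int_absorb2)
  finally have "\<tau> * (4 * real h - 4) \<le> 2 * (2 - \<nu> * (2 * real h))" by (simp only: balance_S)
  moreover have "4 * real h * \<mu> + (4 * real h - 4) * \<tau> = 4"
    using tau_eq by (simp add: algebra_simps)
  ultimately have "\<nu> * real h \<le> \<mu> * real h" by (simp add: algebra_simps)
  then show ?thesis using h_ge nu_ge by simp
qed

text \<open>Since \<nu> = \<mu>, every estimate in \<open>eigenvalue_eq\<close> is sharp: non-bad
  edges have energy exactly \<tau> and the bad edge has energy 0.\<close>

lemma bad_energy:
  obtains x0 y0 where "bad = {(x0, y0), (y0, x0)}" "(x0, y0) \<in> E" "f x0 = f y0"
    "\<And>x y. (x, y) \<in> E - bad \<Longrightarrow> f y / f x = 1 - \<mu> \<or> f x / f y = 1 - \<mu>"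
proof -
  define t where "t = (\<lambda>(x, y). f y / f x + f x / f y - 2)"
  \<comment> \<open>Splits the total arc energy into the excess over \<tau> on non-bad arcs, the
    energy of bad arcs and \<tau> per non-bad arc. With at least 4h - 4 non-bad arcs, the first two
    parts must vanish.\<close>
  have tot: "(\<Sum>e\<in>E - bad. t e - \<tau>) + (\<Sum>e\<in>bad. t e) + \<tau> * card (E - bad) = \<tau> * (4 * real h - 4)"
  proof -
    have "(\<Sum>e\<in>E - bad. t e) + (\<Sum>e\<in>bad. t e) = (\<Sum>e\<in>E. t e)"
      using finite_E by (intro sum.subset_diff[symmetric]) (auto simp: bad_def)
    also have "\<dots> = 2 * energy S"
      using E_sub by (simp add: energy_def t_def Int_absorb2)
    also have "\<dots> = 2 * (2 - \<mu> * (2 * real h))" by (simp only: balance_S eigenvalue_eq)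
    also have "\<dots> = \<tau> * (4 * real h - 4)" using tau_eq by (simp add: algebra_simps)
    finally show ?thesis by (simp add: sum_subtractf)
  qed
  have t1: "t e - \<tau> \<ge> 0" if "e \<in> E - bad" for e
    using not_bad_energy that by (cases e) (simp add: t_def)
  have t2: "t e \<ge> 0" if "e \<in> bad" for e
    using energy_term_nonneg that by (auto simp: t_def bad_def)
  have n1: "(\<Sum>e\<in>E - bad. t e - \<tau>) \<ge> 0" using t1 by (rule sum_nonneg)
  have n2: "(\<Sum>e\<in>bad. t e) \<ge> 0" using t2 by (rule sum_nonneg)
  \<comment> \<open>Without a bad edge, 4h - 2 arcs of energy at least \<tau> would exceed the
    total.\<close>
  have "bad \<noteq> {}"
  proof
    assume "bad = {}"
    then have "real (4 * h) \<le> real (card (E - bad) + 2)" using E_arcs_h by simp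
    then have "\<tau> * (4 * real h - 2) \<le> \<tau> * card (E - bad)" using tau_pos by simp
    then show False using tot n1 n2 tau_pos by (simp add: algebra_simps)
  qed
  then obtain x0 y0 where b: "(x0, y0) \<in> bad" by auto
  have bad: "bad = {(x0, y0), (y0, x0)}" using bad_unique[OF b] b bad_sym[OF b] by auto
  have "real (4 * h) \<le> real (card (E - bad) + 4)"
    using E_arcs_h card_bad card_not_bad by linarith
  then have "\<tau> * (4 * real h - 4) \<le> \<tau> * card (E - bad)" using tau_pos by simp
  then have z1: "(\<Sum>e\<in>E - bad. t e - \<tau>) = 0" and z2: "(\<Sum>e\<in>bad. t e) = 0"
    using tot n1 n2 by linarith+
  have "t e = \<tau>" if "e \<in> E - bad" for e
    using z1 that finite_E t1 by (subst (asm) sum_nonneg_eq_0_iff) auto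
  then have "f y / f x = 1 - \<mu> \<or> f x / f y = 1 - \<mu>" if "(x, y) \<in> E - bad" for x y
    using that E_f_pos[of x y] mu_pos mu_less ratio_energy_eq[of "f x" "f y" \<mu>]
    by (auto simp: t_def \<tau>_def)
  moreover have "t (x0, y0) = 0"
    using z2 b finite_bad t2 by (subst (asm) sum_nonneg_eq_0_iff) auto
  then have "f x0 = f y0"
    using E_f_pos[OF bad_E[OF b]] ratio_energy_zero[of "f x0" "f y0"] by (simp add: t_def)
  ultimately show thesis using that bad bad_E[OF b] by blast
qed

end

section \<open>The case of equality\<close>

definition star :: "'a \<Rightarrow> 'a set \<Rightarrow> 'a rel" where
  "star c A = {c} \<times> (A - {c}) \<union> (A - {c}) \<times> {c}"

context eigen_tree
begin

text \<open>The eigenvalue equation at the centre of an extremal star: charge 1 and h - 1 neighbours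
  larger by the factor 1 / (1 - \<mu>).\<close>

lemma mu_h: "(real h - 1) * (\<mu> / (1 - \<mu>)) = 1 - \<mu>"
  using mu_eq mu_less by (simp add: field_simps power2_eq_square)

text \<open>The equation at a vertex with \<open>p\<close> lower and \<open>n\<close> higher neighbours and charge \<open>j\<close>, where
  neighbouring values differ by the factor \<open>1 - \<mu>\<close>.\<close>

lemma degree_equation:
  fixes p n :: nat and j :: int
  assumes eq: "p * \<mu> - n * (\<mu> / (1 - \<mu>)) + j = \<mu>" and le: "p + n < h"
  shows "p = 1 \<and> n = 0 \<and> j = 0 \<or> p = 0 \<and> n = h - 1 \<and> j = 1"
proof -
  define \<kappa> where "\<kappa> = \<mu> / (1 - \<mu>)"
  have \<kappa>: "\<kappa> > 0" using mu_pos mu_less by (simp add: \<kappa>_def)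
  have h\<kappa>: "(real h - 1) * \<kappa> = 1 - \<mu>" using mu_h by (simp add: \<kappa>_def)
  have "n * \<kappa> \<le> (real h - 1) * \<kappa>"
    using \<kappa> le by (intro mult_right_mono) linarith+
  then have n: "0 \<le> n * \<kappa>" "n * \<kappa> \<le> 1 - \<mu>" using \<kappa> h\<kappa> by simp_all
  have j: "j = \<mu> - p * \<mu> + n * \<kappa>" using eq by (simp add: \<kappa>_def)
  \<comment> \<open>In each case the integer \<open>j\<close> is confined to an interval that
    contains just one integer: 1 for p = 0, and 0 otherwise.\<close>
  consider "p = 0" | "p = 1" | "p \<ge> 2" by linarith
  then show ?thesis
  proof cases
    case 1
    have "0 < real_of_int j" "real_of_int j < 2" using j n 1 mu_pos by simp_all
    then have "j = 1" by linarith
    with j 1 have "n * \<kappa> = (real h - 1) * \<kappa>" unfolding h\<kappa> by simp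
    then have "real n = real h - 1" using \<kappa> by simp
    then show ?thesis using 1 \<open>j = 1\<close> by linarith
  next
    case 2
    have "0 \<le> real_of_int j" "real_of_int j < 1" using j n 2 mu_pos by simp_all
    then have "j = 0" by linarith
    with j 2 \<kappa> show ?thesis by simp
  next
    case 3
    have "(real p - 1) * \<mu> \<le> real h * \<mu>"
      using le mu_pos by (intro mult_right_mono) auto
    also have "\<dots> < 1" using tau_eq mult_pos_pos[of "real h - 1" \<tau>] tau_pos h_ge by linarith
    finally have lt: "(real p - 1) * \<mu> < 1" .
    have gt: "(real p - 1) * \<mu> > 0" using 3 mu_pos by simp
    have j': "j = n * \<kappa> - (real p - 1) * \<mu>" using j by (simp add: algebra_simps)
    then have "-1 < real_of_int j" "real_of_int j < 1" using lt gt n mu_pos by simp_all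
    then have "j = 0" by linarith
    \<comment> \<open>Cancelling \<mu> gives n = (p - 1) (1 - \<mu>). Then p - 1 - n = (p - 1) \<mu>
      is an integer strictly between 0 and 1.\<close>
    then have "n * \<kappa> * (1 - \<mu>) = (real p - 1) * \<mu> * (1 - \<mu>)" using j' by simp
    moreover have "\<kappa> * (1 - \<mu>) = \<mu>" using mu_less by (simp add: \<kappa>_def)
    ultimately have "real n * \<mu> = (real p - 1) * \<mu> * (1 - \<mu>)" by (metis mult.assoc)
    then have "real n * \<mu> = (real p - 1) * (1 - \<mu>) * \<mu>" by (simp only: mult_ac)
    then have "real n = (real p - 1) * (1 - \<mu>)" using mu_pos by simp
    then have "(real p - 1) * \<mu> = real p - 1 - real n" by (simp add: algebra_simps)
    then have "real (n + 1) < real p" "real p < real (n + 2)" using lt gt by simp_all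
    then have "n + 1 < p" "p < n + 2" by (simp_all only: of_nat_less_iff)
    then show ?thesis by linarith
  qed
qed

lemma bad_f_eq: "(x, y) \<in> bad \<Longrightarrow> f x = f y"
  by (rule bad_energy) auto

lemma not_bad_ratio: "(x, y) \<in> E - bad \<Longrightarrow> f y = (1 - \<mu>) * f x \<or> f x = (1 - \<mu>) * f y"
proof -
  assume a: "(x, y) \<in> E - bad"
  then have "f y / f x = 1 - \<mu> \<or> f x / f y = 1 - \<mu>" using bad_energy by (metis (no_types, lifting))
  then show ?thesis using a E_f_pos[of x y] by (auto simp: nonzero_divide_eq_eq)
qed

lemma bad_side: "(x, y) \<in> bad \<Longrightarrow> bad \<inter> side x y \<times> side x y = {}"
  using bad_unique side_other bad_E by blast

text \<open>As \<open>f\<close> agrees at the ends of the bad edge, a side with n vertices satisfies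
  n \<mu> + (n - 1) \<tau> \<le> 1, so n \<le> h by \<open>tau_eq\<close>. The sides have 2h
  vertices in all.\<close>

lemma card_bad_side:
  assumes "(x, y) \<in> bad"
  shows "card (side x y) = h"
proof -
  have le: "card (side x y) \<le> h" if b: "(x, y) \<in> bad" for x y
  proof -
    have "\<tau> * (real (card (side x y)) - 1) \<le> energy (side x y)"
      using energy_side_ge[OF bad_E[OF b] bad_side[OF b]] .
    moreover have "1 - f y / f x = 0" using bad_f_eq[OF b] E_f_pos[OF bad_E[OF b]] by simp
    ultimately have "\<mu> * card (side x y) + \<tau> * (real (card (side x y)) - 1) \<le> 1"
      using balance_side[OF bad_E[OF b]] bad_charge[OF b] eigenvalue_eq by simp
    also have "1 = real h * \<mu> + (real h - 1) * \<tau>" using tau_eq by simp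
    finally have "(\<mu> + \<tau>) * card (side x y) \<le> (\<mu> + \<tau>) * real h" by (simp add: algebra_simps)
    then show ?thesis using mu_pos tau_pos by simp
  qed
  show ?thesis using le[OF assms] le[OF bad_sym[OF assms]] card_sides[OF bad_E[OF assms]] by linarith
qed

lemma ratio_asym:
  assumes "u \<in> S" "v \<in> S" "f u = (1 - \<mu>) * f v"
  shows "f v \<noteq> (1 - \<mu>) * f u"
proof -
  have less: "f a < f b" if "b \<in> S" "f a = (1 - \<mu>) * f b" for a b
    using that f_pos[of b] mu_pos by (simp add: left_diff_distrib)
  show ?thesis using less[OF assms(2,3)] less[OF assms(1), of v] by auto
qed

text \<open>The two solutions of \<open>degree_equation\<close>: an uncharged arm with one lower
  neighbour, or a charged centre whose h - 1 higher neighbours exhaust the side.\<close>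

lemma side_vertex:
  assumes b: "(x, y) \<in> bad" and v: "v \<in> side x y"
  defines "N \<equiv> E `` {v} \<inter> side x y"
  shows "m v = 0 \<and> (\<exists>z. N = {z} \<and> f z = (1 - \<mu>) * f v) \<or>
    m v = 1 \<and> N = side x y - {v} \<and> (\<forall>z\<in>N. f v = (1 - \<mu>) * f z)"
proof -
  note e = bad_E[OF b]
  define P where "P = {z \<in> N. f z = (1 - \<mu>) * f v}"
  define U where "U = {z \<in> N. f v = (1 - \<mu>) * f z}"
  have vS: "v \<in> S" "f v > 0" using v side_sub[OF e] f_pos by auto
  have fin: "finite N" "finite P" "finite U" unfolding P_def U_def by (auto simp: N_def intro: finite_subset[OF _ finite_nb[of v]])
  have NPU: "N = P \<union> U"
  proof -
    have "(v, z) \<in> E - bad" if "z \<in> N" for z using that v bad_side[OF b] by (auto simp: N_def)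
    then show ?thesis using not_bad_ratio by (auto simp: P_def U_def)
  qed
  have disj: "P \<inter> U = {}"
    using ratio_asym[OF _ vS(1)] side_sub[OF e] unfolding P_def U_def N_def by blast
  \<comment> \<open>The only neighbour outside the side lies across the bad edge, where
    \<open>f\<close> has the same value.\<close>
  have "(\<Sum>z\<in>E `` {v}. f v - f z) = (\<Sum>z\<in>N. f v - f z)"
  proof (intro sum.mono_neutral_right ballI)
    fix z assume z: "z \<in> E `` {v} - N"
    then have "v = x \<and> z = y" using side_step[OF e v] by (auto simp: N_def)
    then show "f v - f z = 0" using bad_f_eq[OF b] by simp
  qed (auto simp: N_def)
  also have "\<dots> = (\<Sum>z\<in>P. f v - f z) + (\<Sum>z\<in>U. f v - f z)"
    unfolding NPU using fin disj by (intro sum.union_disjoint) auto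
  also have "(\<Sum>z\<in>P. f v - f z) = (\<Sum>z\<in>P. \<mu> * f v)"
    by (intro sum.cong) (auto simp: P_def algebra_simps)
  also have "(\<Sum>z\<in>U. f v - f z) = (\<Sum>z\<in>U. - (\<mu> / (1 - \<mu>)) * f v)"
    using mu_less by (intro sum.cong) (auto simp: U_def field_simps)
  finally have "card P * (\<mu> * f v) + card U * (- (\<mu> / (1 - \<mu>)) * f v) + m v * f v = \<mu> * f v"
    using eigen[OF vS(1)] eigenvalue_eq by (simp add: lap_def)
  then have "(card P * \<mu> - card U * (\<mu> / (1 - \<mu>)) + m v) * f v = \<mu> * f v"
    by (simp add: algebra_simps)
  then have "card P * \<mu> - card U * (\<mu> / (1 - \<mu>)) + m v = \<mu>" using vS by simp
  moreover have Nsub: "N \<subseteq> side x y - {v}" using irrefl by (auto simp: N_def)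
  have cardA: "card (side x y - {v}) = h - 1" using v card_bad_side[OF b] by simp
  have "card N \<le> h - 1"
    using card_mono[OF _ Nsub] finite_side[OF e] cardA by simp
  then have "card P + card U < h"
    using card_Un_disjoint[of P U] fin disj NPU h_ge by simp
  ultimately have "card P = 1 \<and> card U = 0 \<and> m v = 0 \<or> card P = 0 \<and> card U = h - 1 \<and> m v = 1"
    by (rule degree_equation)
  then show ?thesis
  proof
    assume a: "card P = 1 \<and> card U = 0 \<and> m v = 0"
    then obtain z where z: "P = {z}" by (auto simp: card_1_singleton_iff)
    then have "z \<in> P" by simp
    then have "f z = (1 - \<mu>) * f v" unfolding P_def by blast
    moreover have "N = {z}" using a fin NPU z by simp
    ultimately show ?thesis using a by blast
  next
    assume a: "card P = 0 \<and> card U = h - 1 \<and> m v = 1"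
    then have "N = U" using NPU fin by simp
    moreover have "N = side x y - {v}"
      using Nsub a cardA finite_side[OF e] \<open>N = U\<close> by (intro card_subset_eq) auto
    moreover have "\<forall>z\<in>U. f v = (1 - \<mu>) * f z" unfolding U_def by blast
    ultimately show ?thesis using a by blast
  qed
qed

text \<open>Once a vertex with charge 1 is found, it is adjacent to the whole side and lower than
  everything else; the other vertices must then be arms.\<close>

lemma side_star:
  assumes b: "(x, y) \<in> bad"
  obtains c where "c \<in> side x y" "m c = 1" "\<And>v. v \<in> side x y - {c} \<Longrightarrow> m v = 0"
    "E \<inter> side x y \<times> side x y = star c (side x y)"
proof -
  define A where "A = side x y"
  note e = bad_E[OF b]
  note vert = side_vertex[OF b, folded A_def]
  have up: "\<not> f z = (1 - \<mu>) * f v" if "v \<in> A" "f v = (1 - \<mu>) * f z" "z \<in> A" for v z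
    using ratio_asym[of v z] that side_sub[OF e] unfolding A_def by blast
  have "\<exists>c\<in>A. m c = 1"
  proof (cases "m x = 1")
    case False
    have xA: "x \<in> A" by (simp add: A_def)
    from vert[OF xA] False obtain z where z: "E `` {x} \<inter> A = {z}" "f z = (1 - \<mu>) * f x" by auto
    have zA: "z \<in> A" "x \<in> E `` {z} \<inter> A" using z xA E_symD by auto
    \<comment> \<open>If \<open>x\<close> is an arm, its neighbour \<open>z\<close> is lower. Were
      \<open>z\<close> an arm too, its only neighbour \<open>x\<close> would be lower than
      \<open>z\<close>.\<close>
    have "m z = 1"
    proof (rule ccontr)
      assume "m z \<noteq> 1"
      with vert[OF zA(1)] zA(2) have "f x = (1 - \<mu>) * f z" by (metis singletonD)
      with up[OF xA this zA(1)] z show False by blast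
    qed
    with zA show ?thesis by blast
  qed (auto simp: A_def)
  then obtain c where c: "c \<in> A" "m c = 1" by blast
  from vert[OF c(1)] c(2) have Nc: "E `` {c} \<inter> A = A - {c}"
    and fc: "\<And>z. z \<in> A - {c} \<Longrightarrow> f c = (1 - \<mu>) * f z" by auto
  have leaf: "m v = 0 \<and> E `` {v} \<inter> A = {c}" if v: "v \<in> A - {c}" for v
  proof -
    have "c \<in> E `` {v} \<inter> A" using Nc v c E_symD by auto
    moreover have "\<not> f v = (1 - \<mu>) * f c" using up[OF c(1) fc[OF v]] v by blast
    moreover have "v \<in> A" using v by blast
    ultimately show ?thesis using vert[OF \<open>v \<in> A\<close>] by (metis singletonD)
  qed
  have "E \<inter> A \<times> A = star c A"
  proof (intro equalityI subrelI)
    fix u v assume uv: "(u, v) \<in> E \<inter> A \<times> A"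
    then have "v \<in> E `` {u} \<inter> A" "u \<in> A" by auto
    then show "(u, v) \<in> star c A"
      using Nc leaf[of u] by (cases "u = c") (auto simp: star_def)
  next
    fix u v assume "(u, v) \<in> star c A"
    then have "u = c \<and> v \<in> E `` {c} \<inter> A \<or> v = c \<and> u \<in> E `` {c} \<inter> A"
      unfolding Nc by (auto simp: star_def)
    then show "(u, v) \<in> E \<inter> A \<times> A" using c(1) E_symD by auto
  qed
  then show thesis using that[of c] c leaf by (auto simp: A_def)
qed

lemma two_stars:
  obtains c1 c2 A1 A2 x0 y0 where
    "S = A1 \<union> A2" "A1 \<inter> A2 = {}" "card A1 = h" "card A2 = h"
    "c1 \<in> A1" "c2 \<in> A2" "x0 \<in> A1" "y0 \<in> A2"
    "m c1 = 1" "m c2 = 1" "\<And>v. v \<in> S - {c1, c2} \<Longrightarrow> m v = 0"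
    "E = star c1 A1 \<union> star c2 A2 \<union> {(x0, y0), (y0, x0)}"
proof -
  obtain x0 y0 where b: "(x0, y0) \<in> bad" by (rule bad_energy) blast
  note e = bad_E[OF b]
  obtain c1 where 1: "c1 \<in> side x0 y0" "m c1 = 1" "\<And>v. v \<in> side x0 y0 - {c1} \<Longrightarrow> m v = 0"
    "E \<inter> side x0 y0 \<times> side x0 y0 = star c1 (side x0 y0)"
    using side_star[OF b] by metis
  obtain c2 where 2: "c2 \<in> side y0 x0" "m c2 = 1" "\<And>v. v \<in> side y0 x0 - {c2} \<Longrightarrow> m v = 0"
    "E \<inter> side y0 x0 \<times> side y0 x0 = star c2 (side y0 x0)"
    using side_star[OF bad_sym[OF b]] by metis
  have "E = star c1 (side x0 y0) \<union> star c2 (side y0 x0) \<union> {(x0, y0), (y0, x0)}"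
  proof (intro equalityI subrelI)
    fix u v assume uv: "(u, v) \<in> E"
    then have "u \<in> side x0 y0 \<union> side y0 x0" "v \<in> side x0 y0 \<union> side y0 x0"
      using E_sub side_Un[OF e] by auto
    then show "(u, v) \<in> star c1 (side x0 y0) \<union> star c2 (side y0 x0) \<union> {(x0, y0), (y0, x0)}"
      using uv side_step[OF e, of u v] side_step[OF E_symD[OF e], of u v]
      unfolding 1(4)[symmetric] 2(4)[symmetric] by blast
  next
    fix u v assume "(u, v) \<in> star c1 (side x0 y0) \<union> star c2 (side y0 x0) \<union> {(x0, y0), (y0, x0)}"
    then show "(u, v) \<in> E"
      unfolding 1(4)[symmetric] 2(4)[symmetric] using e E_symD[OF e] by blast
  qed
  moreover have "m v = 0" if "v \<in> S - {c1, c2}" for v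
    using that 1(3) 2(3) side_Un[OF e] by blast
  ultimately show thesis
    using that[of "side x0 y0" "side y0 x0" c1 c2 x0 y0] side_Un[OF e] side_disjoint[OF e]
      card_bad_side[OF b] card_bad_side[OF bad_sym[OF b]] 1(1,2) 2(1,2) by simp
qed

end

section \<open>Dirichlet eigenvalues of trees\<close>

locale dirichlet_tree =
  fixes T :: "'a pair_pre_digraph"
  assumes tree: "tree_graph T" and interior_nonempty: "interior_verts T \<noteq> {}"
begin

sublocale pair_graph T
  using tree by (simp add: tree_graph_def)

abbreviation S :: "'a set" where "S \<equiv> interior_verts T"

definition E :: "'a rel" where "E = parcs T \<inter> S \<times> S"

definition leaf_nbrs :: "'a \<Rightarrow> 'a set" where "leaf_nbrs x = nbrs T x \<inter> leaves T"

lemma arcs_sym: "(x, y) \<in> parcs T \<Longrightarrow> (y, x) \<in> parcs T"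
  using pair_sym_arcs by (auto simp: symmetric_def dest: symD)

lemma finite_nbrs: "finite (nbrs T x)"
proof -
  have "nbrs T x \<subseteq> pverts T" by (auto simp: nbrs_def dest: in_arcsD2)
  then show ?thesis using pair_finite_verts finite_subset by blast
qed

lemma verts_Un: "pverts T = S \<union> leaves T" and verts_disj: "S \<inter> leaves T = {}"
  by (auto simp: interior_verts_def leaves_def)

lemma finite_S: "finite S" and finite_leaves: "finite (leaves T)"
  using pair_finite_verts verts_Un by (metis finite_Un)+

lemma arcs_connected:
  assumes "x \<in> pverts T" "y \<in> pverts T"
  shows "(x, y) \<in> (parcs T)\<^sup>*"
proof -
  have "x \<rightarrow>\<^sup>*\<^bsub>with_proj (mk_symmetric (with_proj T))\<^esub> y"
    using tree assms by (auto simp: tree_graph_def connected_def strongly_connected_def)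
  then have "(x, y) \<in> (parcs (mk_symmetric (with_proj T)))\<^sup>*"
    using reachable_rtranclI by fastforce
  moreover have "parcs (mk_symmetric (with_proj T)) \<subseteq> parcs T"
    using arcs_sym by (auto simp: mk_symmetric_def)
  ultimately show ?thesis using rtrancl_mono by blast
qed

text \<open>A path from x to y avoiding the edge has at least two arcs, as there are no loops and
  the arc itself is removed. Closing it with (y, x) gives a forbidden cycle of length at least
  three.\<close>

lemma arc_bridge:
  assumes xy: "(x, y) \<in> parcs T"
  shows "(x, y) \<notin> (parcs T - {(x, y), (y, x)})\<^sup>*"
proof
  assume reach: "(x, y) \<in> (parcs T - {(x, y), (y, x)})\<^sup>*"
  define H where "H = \<lparr>pverts = pverts T, parcs = parcs T - {(x, y), (y, x)}\<rparr>"
  interpret H: pair_wf_digraph H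
    by unfold_locales (auto simp: H_def dest: in_arcsD1 in_arcsD2)
  have "x \<rightarrow>\<^sup>*\<^bsub>with_proj H\<^esub> y"
    unfolding H.reachable_conv using reach in_arcsD1[OF xy] in_arcsD2[OF xy] by (simp add: H_def)
  then obtain p where p: "H.apath x p y" using H.reachable_apath by blast
  then have *: "pcas x p y" "distinct (pawalk_verts x p)" "set p \<subseteq> parcs H"
    by (auto simp: H.apath_def H.awalk_def)
  have "x \<noteq> y" using xy no_loops' by blast
  then have "p \<noteq> []" using *(1) by auto
  moreover have "length p \<noteq> 1"
  proof
    assume "length p = 1"
    then obtain a where "p = [a]" by (auto simp: length_Suc_conv)
    with * have "(x, y) \<in> parcs H" by (cases a) auto
    then show False by (simp add: H_def)
  qed
  ultimately have "length p \<ge> 2" by (cases p) (auto simp: Suc_le_eq)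
  moreover have "awalk y ((y, x) # p) y"
    using * arcs_sym[OF xy] in_arcsD2[OF xy] by (auto simp: awalk_def H_def)
  then have "cycle ((y, x) # p)" using *(2) by (auto simp: cycle_def)
  ultimately show False using tree by (auto simp: tree_graph_def)
qed

text \<open>A walk entering a leaf can only go back. The invariant at a leaf records that its sole
  neighbour was already reached through the interior.\<close>

lemma interior_reach:
  assumes x: "x \<in> S" and "(x, z) \<in> (parcs T)\<^sup>*"
  shows "(z \<in> S \<longrightarrow> (x, z) \<in> E\<^sup>*) \<and> (z \<in> leaves T \<longrightarrow> (\<forall>y\<in>nbrs T z. (x, y) \<in> E\<^sup>*))"
  using assms(2)
proof (induction rule: rtrancl_induct)
  case base
  then show ?case using x verts_disj by auto
next
  case (step z z')
  have z: "z \<in> S \<union> leaves T" "z' \<in> S \<union> leaves T"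
    using step.hyps(2) in_arcsD1 in_arcsD2 verts_Un by blast+
  show ?case
  proof (cases "z \<in> S")
    case True
    then have xz: "(x, z) \<in> E\<^sup>*" using step.IH by blast
    show ?thesis
    proof (intro conjI impI ballI)
      assume "z' \<in> S"
      with True step.hyps(2) have "(z, z') \<in> E" by (simp add: E_def)
      with xz show "(x, z') \<in> E\<^sup>*" by simp
    next
      fix y assume "z' \<in> leaves T" "y \<in> nbrs T z'"
      moreover have "z \<in> nbrs T z'" using arcs_sym[OF step.hyps(2)] by (simp add: nbrs_def)
      ultimately have "y = z" by (auto simp: leaves_def card_1_singleton_iff)
      with xz show "(x, y) \<in> E\<^sup>*" by simp
    qed
  next
    case False
    then have "z \<in> leaves T" "z' \<in> nbrs T z" using z step.hyps(2) by (auto simp: nbrs_def)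
    then have xz': "(x, z') \<in> E\<^sup>*" using step.IH by blast
    then have "z' \<in> S" using x by (cases rule: rtranclE) (auto simp: E_def)
    with xz' verts_disj show ?thesis by blast
  qed
qed

text \<open>Two adjacent leaves would form a component of their own, yet an interior vertex exists
  and the tree is connected.\<close>

lemma leaf_nbrE:
  assumes "z \<in> leaves T"
  obtains y where "y \<in> S" "nbrs T z = {y}"
proof -
  obtain x where x: "x \<in> S" using interior_nonempty by blast
  obtain y where y: "nbrs T z = {y}" using assms by (auto simp: leaves_def card_1_singleton_iff)
  have "(x, y) \<in> E\<^sup>*"
    using interior_reach[OF x arcs_connected] x assms y verts_Un by blast
  then have "y \<in> S" using x by (cases rule: rtranclE) (auto simp: E_def)
  with y that show thesis by blast
qed

sublocale weighted_tree S E "\<lambda>x. real (card (leaf_nbrs x))"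
proof
  show "sym E" using arcs_sym by (auto simp: E_def intro!: symI)
  show "(x, y) \<in> E\<^sup>*" if "x \<in> S" "y \<in> S" for x y
    using interior_reach[OF that(1) arcs_connected] that verts_Un by blast
  show "(x, y) \<notin> (E - {(x, y), (y, x)})\<^sup>*" if "(x, y) \<in> E" for x y
  proof -
    have "(E - {(x, y), (y, x)})\<^sup>* \<subseteq> (parcs T - {(x, y), (y, x)})\<^sup>*"
      by (intro rtrancl_mono) (auto simp: E_def)
    moreover have "(x, y) \<in> parcs T" using that by (simp add: E_def)
    ultimately show ?thesis using arc_bridge by blast
  qed
qed (use finite_S interior_nonempty in \<open>auto simp: E_def\<close>)

lemma leaves_eq: "leaves T = (\<Union>x\<in>S. leaf_nbrs x)"
proof (intro equalityI subsetI)
  fix z assume z: "z \<in> leaves T"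
  then obtain y where "y \<in> S" "nbrs T z = {y}" by (rule leaf_nbrE)
  then have "y \<in> S" "z \<in> leaf_nbrs y"
    using z arcs_sym by (auto simp: leaf_nbrs_def nbrs_def)
  then show "z \<in> (\<Union>x\<in>S. leaf_nbrs x)" by blast
qed (auto simp: leaf_nbrs_def)

lemma leaf_nbrs_unique:
  assumes z: "z \<in> leaf_nbrs x" "z \<in> leaf_nbrs y"
  shows "x = y"
proof -
  obtain w where "nbrs T z = {w}" using z leaf_nbrE[of z] by (auto simp: leaf_nbrs_def)
  moreover have "x \<in> nbrs T z" "y \<in> nbrs T z" using z arcs_sym by (auto simp: leaf_nbrs_def nbrs_def)
  ultimately show "x = y" by simp
qed

lemma finite_leaf_nbrs: "finite (leaf_nbrs x)"
  using finite_nbrs by (simp add: leaf_nbrs_def)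

lemma sum_leaf_nbrs: "(\<Sum>x\<in>S. card (leaf_nbrs x)) = card (leaves T)"
  unfolding leaves_eq using finite_S finite_leaf_nbrs leaf_nbrs_unique
  by (subst card_UN_disjoint) blast+

lemma nbrs_interior: "x \<in> S \<Longrightarrow> nbrs T x = E `` {x} \<union> leaf_nbrs x"
  using verts_Un in_arcsD2 by (auto simp: nbrs_def E_def leaf_nbrs_def)

text \<open>Each leaf at \<open>x\<close> contributes \<open>f x\<close>, so the Dirichlet condition
  turns leaves into the potential.\<close>

lemma lap_eq:
  assumes "x \<in> S" "\<And>z. z \<in> leaves T \<Longrightarrow> f z = 0"
  shows "(\<Sum>y\<in>nbrs T x. f x - f y) = lap f x"
proof -
  have "E `` {x} \<inter> leaf_nbrs x = {}" using verts_disj by (auto simp: E_def leaf_nbrs_def)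
  then have "(\<Sum>y\<in>nbrs T x. f x - f y) = (\<Sum>y\<in>E `` {x}. f x - f y) + (\<Sum>y\<in>leaf_nbrs x. f x - f y)"
    unfolding nbrs_interior[OF assms(1)] using finite_nbrs
    by (intro sum.union_disjoint) (auto simp: leaf_nbrs_def)
  also have "(\<Sum>y\<in>leaf_nbrs x. f x - f y) = (\<Sum>y\<in>leaf_nbrs x. f x)"
    using assms(2) by (intro sum.cong) (auto simp: leaf_nbrs_def)
  finally show ?thesis by (simp add: lap_def)
qed

lemma lap_cong: "(\<And>y. y \<in> S \<Longrightarrow> f y = g y) \<Longrightarrow> x \<in> S \<Longrightarrow> lap f x = lap g x"
  using E_sub by (auto simp: lap_def intro!: sum.cong)

text \<open>Positivity singles out the least eigenvalue, by the maximum principle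
  \<open>positive_eigenfunction_least\<close>. Extension by zero to the leaves shows that it is
  attained.\<close>

lemma first_dirichlet_eigenvalueI:
  assumes pos: "\<And>x. x \<in> S \<Longrightarrow> f x > 0" and eig: "\<And>x. x \<in> S \<Longrightarrow> lap f x = \<nu> * f x"
  shows "first_dirichlet_eigenvalue T = \<nu>"
  unfolding first_dirichlet_eigenvalue_def
proof (rule Least_equality)
  define g where "g x = (if x \<in> S then f x else 0)" for x
  obtain x where "x \<in> S" using interior_nonempty by blast
  moreover have g0: "g z = 0" if "z \<in> leaves T" for z using that verts_disj by (auto simp: g_def)
  moreover have "(\<Sum>y\<in>nbrs T x. g x - g y) = \<nu> * g x" if "x \<in> S" for x
    using lap_eq[of x g, OF that g0] lap_cong[of g f, OF _ that] eig[OF that] that by (simp add: g_def)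
  ultimately show "dirichlet_eigenvalue T \<nu>"
    unfolding dirichlet_eigenvalue_def using pos verts_Un
    by (intro exI[of _ g]) (force simp: g_def)
next
  fix \<mu> assume "dirichlet_eigenvalue T \<mu>"
  then obtain g where g: "\<exists>x\<in>pverts T. g x \<noteq> 0" "\<And>z. z \<in> leaves T \<Longrightarrow> g z = 0"
    "\<And>x. x \<in> S \<Longrightarrow> (\<Sum>y\<in>nbrs T x. g x - g y) = \<mu> * g x"
    unfolding dirichlet_eigenvalue_def by blast
  then obtain z where "z \<in> S" "g z \<noteq> 0" using verts_Un by auto
  moreover have "lap g x = \<mu> * g x" if "x \<in> S" for x
    using g(3)[OF that] lap_eq[of x g, OF that g(2)] by simp
  ultimately show "\<nu> \<le> \<mu>" using positive_eigenfunction_least[OF pos eig] by blast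
qed

text \<open>Subtracting \<open>a\<close> from every leaf count shifts the spectrum by \<open>a\<close> and leaves total charge 2.\<close>

lemma first_eigenvalue_bound:
  fixes \<mu> :: real and a h :: nat
  assumes card_S: "card S = 2 * h" and h: "h \<ge> 2" and card_leaves: "card (leaves T) = a * (2 * h) + 2"
    and mu: "\<mu>\<^sup>2 - (real h + 1) * \<mu> + 1 = 0" "0 < \<mu>" "\<mu> < 1"
  shows "first_dirichlet_eigenvalue T \<le> a + \<mu>"
    and "first_dirichlet_eigenvalue T = a + \<mu> \<Longrightarrow> \<exists>c1 c2 A1 A2 x0 y0.
      S = A1 \<union> A2 \<and> A1 \<inter> A2 = {} \<and> card A1 = h \<and> card A2 = h \<and>
      c1 \<in> A1 \<and> c2 \<in> A2 \<and> x0 \<in> A1 \<and> y0 \<in> A2 \<and>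
      (\<forall>v\<in>S. card (leaf_nbrs v) = (if v \<in> {c1, c2} then a + 1 else a)) \<and>
      E = star c1 A1 \<union> star c2 A2 \<union> {(x0, y0), (y0, x0)}"
proof -
  obtain f \<nu> where f: "\<And>x. x \<in> S \<Longrightarrow> f x > 0" "\<And>x. x \<in> S \<Longrightarrow> lap f x = \<nu> * f x"
    using ex_positive_eigenfunction by blast
  have nu: "first_dirichlet_eigenvalue T = \<nu>" by (rule first_dirichlet_eigenvalueI[OF f])
  define m where "m x = int (card (leaf_nbrs x)) - int a" for x
  interpret M: weighted_tree S E "\<lambda>x. real_of_int (m x)"
    using S_nonempty E_sub E_sym E_conn bridge finite_S by unfold_locales auto
  have "M.lap f x = (\<nu> - a) * f x" if "x \<in> S" for x
    unfolding M.lap_def using f(2)[OF that] by (simp add: lap_def m_def algebra_simps)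
  moreover have "(\<Sum>x\<in>S. m x) = 2"
  proof -
    have "(\<Sum>x\<in>S. m x) = int (\<Sum>x\<in>S. card (leaf_nbrs x)) - int a * int (card S)"
      by (simp add: m_def sum_subtractf)
    then show ?thesis by (simp add: sum_leaf_nbrs card_leaves card_S)
  qed
  ultimately have eig: "eigen_tree S E m f (\<nu> - a) \<mu> h" if "\<mu> \<le> \<nu> - a"
    using f(1) card_S h mu that by unfold_locales auto
  \<comment> \<open>Either \<nu> - a is below \<mu>, or the locale \<open>eigen_tree\<close> applies
    and forces equality.\<close>
  show "first_dirichlet_eigenvalue T \<le> a + \<mu>"
  proof (cases "\<mu> \<le> \<nu> - a")
    case True
    then show ?thesis using eigen_tree.eigenvalue_eq[OF eig[OF True]] by (simp add: nu)
  qed (simp add: nu)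
  assume "first_dirichlet_eigenvalue T = a + \<mu>"
  then have "\<mu> \<le> \<nu> - a" by (simp add: nu)
  from eigen_tree.two_stars[OF eig[OF this]] obtain c1 c2 A1 A2 x0 y0 where *:
    "S = A1 \<union> A2" "A1 \<inter> A2 = {}" "card A1 = h" "card A2 = h"
    "c1 \<in> A1" "c2 \<in> A2" "x0 \<in> A1" "y0 \<in> A2"
    "m c1 = 1" "m c2 = 1" "\<And>v. v \<in> S - {c1, c2} \<Longrightarrow> m v = 0"
    "E = star c1 A1 \<union> star c2 A2 \<union> {(x0, y0), (y0, x0)}" by metis
  have "\<forall>v\<in>S. card (leaf_nbrs v) = (if v \<in> {c1, c2} then a + 1 else a)"
    using *(9,10) *(11) by (auto simp: m_def)
  with * show "\<exists>c1 c2 A1 A2 x0 y0.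
      S = A1 \<union> A2 \<and> A1 \<inter> A2 = {} \<and> card A1 = h \<and> card A2 = h \<and>
      c1 \<in> A1 \<and> c2 \<in> A2 \<and> x0 \<in> A1 \<and> y0 \<in> A2 \<and>
      (\<forall>v\<in>S. card (leaf_nbrs v) = (if v \<in> {c1, c2} then a + 1 else a)) \<and>
      E = star c1 A1 \<union> star c2 A2 \<union> {(x0, y0), (y0, x0)}"
    by (intro exI[of _ c1] exI[of _ c2] exI[of _ A1] exI[of _ A2] exI[of _ x0] exI[of _ y0] conjI)
qed

end

section \<open>Star-like path trees\<close>

text \<open>Library isomorphisms carry separate maps for arcs, tails and heads; for pair graphs the
  vertex map determines their action.\<close>

lemma graph_isomorphic_iff:
  assumes "pair_wf_digraph G"
  shows "graph_isomorphic G H \<longleftrightarrow>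
    (\<exists>h. inj_on h (pverts G) \<and> pverts H = h ` pverts G \<and> parcs H = map_prod h h ` parcs G)"
proof
  assume "graph_isomorphic G H"
  then obtain \<phi> where \<phi>: "pre_digraph.digraph_isomorphism (with_proj G) \<phi>"
    and H: "with_proj H = app_iso \<phi> (with_proj G)"
    by (auto simp: graph_isomorphic_def digraph_iso_def)
  define h where "h = iso_verts \<phi>"
  have inj: "inj_on h (pverts G)"
    and ends: "\<And>a. a \<in> parcs G \<Longrightarrow> h (fst a) = iso_tail \<phi> (iso_arcs \<phi> a)"
      "\<And>a. a \<in> parcs G \<Longrightarrow> h (snd a) = iso_head \<phi> (iso_arcs \<phi> a)"
    using \<phi> by (auto simp: pre_digraph.digraph_isomorphism_def h_def)
  have H': "pverts H = h ` pverts G" "parcs H = iso_arcs \<phi> ` parcs G" "iso_tail \<phi> = fst" "iso_head \<phi> = snd"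
    using arg_cong[OF H, of verts] arg_cong[OF H, of arcs] arg_cong[OF H, of tail] arg_cong[OF H, of head]
    by (simp_all add: h_def)
  have "iso_arcs \<phi> a = map_prod h h a" if "a \<in> parcs G" for a
    using ends[OF that] H'(3,4) by (simp add: prod_eq_iff)
  then have "parcs H = map_prod h h ` parcs G" unfolding H'(2) by (intro image_cong) auto
  with inj H' show "\<exists>h. inj_on h (pverts G) \<and> pverts H = h ` pverts G \<and> parcs H = map_prod h h ` parcs G"
    by blast
next
  assume "\<exists>h. inj_on h (pverts G) \<and> pverts H = h ` pverts G \<and> parcs H = map_prod h h ` parcs G"
  then obtain h where h: "inj_on h (pverts G)" "pverts H = h ` pverts G" "parcs H = map_prod h h ` parcs G"
    by blast
  interpret pair_wf_digraph G by fact
  define \<phi> where "\<phi> = \<lparr>iso_verts = h, iso_arcs = map_prod h h, iso_head = snd, iso_tail = fst\<rparr>"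
  have "parcs G \<subseteq> pverts G \<times> pverts G" by (auto dest: in_arcsD1 in_arcsD2)
  then have "inj_on (map_prod h h) (parcs G)" using map_prod_inj_on[OF h(1) h(1)] inj_on_subset by blast
  then have "pre_digraph.digraph_isomorphism (with_proj G) \<phi>"
    using h(1) wf_digraph by (auto simp: digraph_isomorphism_def \<phi>_def)
  moreover have "with_proj H = app_iso \<phi> (with_proj G)"
    using h by (simp add: \<phi>_def app_iso_def with_proj_def)
  ultimately show "graph_isomorphic G H" unfolding graph_isomorphic_def digraph_iso_def by blast
qed

text \<open>The map runs from \<open>H\<close> to \<open>G\<close>, because a given tree is
  parametrised by the vertex labels of a star-like path tree.\<close>

lemma graph_isomorphicI:
  assumes "pair_wf_digraph G" "inj_on h (pverts H)" "h ` pverts H = pverts G"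
    "map_prod h h ` parcs H = parcs G" "parcs H \<subseteq> pverts H \<times> pverts H"
  shows "graph_isomorphic G H"
proof -
  define g where "g = the_inv_into (pverts H) h"
  have gh: "g (h x) = x" if "x \<in> pverts H" for x
    using assms(2) that by (simp add: g_def the_inv_into_f_f)
  have "inj_on g (pverts G)"
    using inj_on_the_inv_into[OF assms(2)] assms(3) by (simp add: g_def)
  moreover have "pverts H = g ` pverts G"
    using gh unfolding assms(3)[symmetric] by (force simp: image_image)
  moreover have "map_prod g g ` parcs G = (\<lambda>e. map_prod g g (map_prod h h e)) ` parcs H"
    unfolding assms(4)[symmetric] by (rule image_image)
  moreover have "\<dots> = (\<lambda>e. e) ` parcs H"
    using assms(5) gh by (intro image_cong) auto
  ultimately show ?thesis unfolding graph_isomorphic_iff[OF assms(1)] by force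
qed

lemma inj_on_UnI:
  "\<lbrakk>inj_on f A; inj_on f B; f ` A \<inter> f ` B = {}\<rbrakk> \<Longrightarrow> inj_on f (A \<union> B)"
  unfolding inj_on_Un by blast

section \<open>Neighbours and leaves in star-like path trees\<close>

definition slp_links :: "nat \<Rightarrow> nat \<Rightarrow> nat \<Rightarrow> slp_vertex rel" where
  "slp_links c d e = {(Spine i, Spine (Suc i)) | i. i < c} \<union> {(Spine 0, ArmL i) | i. i \<in> {1..d}} \<union>
     {(Spine c, ArmR j) | j. j \<in> {1..e}}"

definition slp_core_nbrs :: "nat \<Rightarrow> nat \<Rightarrow> nat \<Rightarrow> slp_vertex \<Rightarrow> slp_vertex set" where
  "slp_core_nbrs c d e w = {v. (w, v) \<in> slp_links c d e \<or> (v, w) \<in> slp_links c d e}"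

lemma slp_links_core: "slp_links c d e \<subseteq> slp_core c d e \<times> slp_core c d e"
  by (auto simp: slp_links_def slp_core_def)

lemma Pendant_notin_core [simp]: "Pendant w l \<notin> slp_core c d e"
  by (auto simp: slp_core_def)

lemma slp_edges_eq: "slp_edges p q c d e = slp_links c d e \<union>
    {(w, Pendant w l) | w l. w \<in> slp_core c d e \<and> l \<in> {1..slp_pendants p q c w}}"
  by (simp add: slp_edges_def slp_links_def)

lemma nbrs_SLP_core:
  assumes "w \<in> slp_core c d e"
  shows "nbrs (SLP p q c d e) w = slp_core_nbrs c d e w \<union> Pendant w ` {1..slp_pendants p q c w}"
proof -
  have "w \<noteq> Pendant v l" for v l using assms by auto
  then show ?thesis using assms by (auto simp: nbrs_def SLP_def slp_edges_eq slp_core_nbrs_def)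
qed

lemma nbrs_SLP_Pendant:
  assumes "w \<in> slp_core c d e" "l \<in> {1..slp_pendants p q c w}"
  shows "nbrs (SLP p q c d e) (Pendant w l) = {w}"
proof -
  have "(v, Pendant w l) \<notin> slp_links c d e" "(Pendant w l, v) \<notin> slp_links c d e" for v
    using slp_links_core[of c d e] by auto
  then show ?thesis using assms by (auto simp: nbrs_def SLP_def slp_edges_eq)
qed

text \<open>Spine length \<open>Suc c\<close> keeps the two spine ends distinct.\<close>

lemma slp_core_nbrs_simps:
  "slp_core_nbrs (Suc c) d e (Spine 0) = insert (Spine 1) (ArmL ` {1..d})"
  "slp_core_nbrs (Suc c) d e (Spine (Suc c)) = insert (Spine c) (ArmR ` {1..e})"
  "0 < i \<Longrightarrow> i \<le> c \<Longrightarrow> slp_core_nbrs (Suc c) d e (Spine i) = {Spine (i - 1), Spine (i + 1)}"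
  "j \<in> {1..d} \<Longrightarrow> slp_core_nbrs (Suc c) d e (ArmL j) = {Spine 0}"
  "j \<in> {1..e} \<Longrightarrow> slp_core_nbrs (Suc c) d e (ArmR j) = {Spine (Suc c)}"
  by (auto simp: slp_core_nbrs_def slp_links_def)

lemma slp_core_cases:
  assumes "w \<in> slp_core (Suc c) d e"
  obtains "w = Spine 0" | "w = Spine (Suc c)" | i where "w = Spine i" "0 < i" "i \<le> c"
    | j where "w = ArmL j" "j \<in> {1..d}" | j where "w = ArmR j" "j \<in> {1..e}"
proof -
  consider i where "w = Spine i" "i \<le> Suc c" | j where "w = ArmL j" "j \<in> {1..d}"
    | j where "w = ArmR j" "j \<in> {1..e}"
    using assms by (auto simp: slp_core_def)
  then show thesis
  proof cases
    case (1 i)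
    then consider "i = 0" | "i = Suc c" | "0 < i" "i \<le> c" by linarith
    then show thesis using that 1 by cases blast+
  qed (use that in blast)+
qed

text \<open>Every core vertex has a pendant and a core neighbour, hence degree at least two.\<close>

lemma
  assumes "p > 0" "q > 0"
  shows leaves_SLP: "leaves (SLP p q (Suc c) d e) =
      {Pendant w l | w l. w \<in> slp_core (Suc c) d e \<and> l \<in> {1..slp_pendants p q (Suc c) w}}"
    and interior_SLP: "interior_verts (SLP p q (Suc c) d e) = slp_core (Suc c) d e"
proof -
  have core: "card (nbrs (SLP p q (Suc c) d e) w) \<noteq> 1" if w: "w \<in> slp_core (Suc c) d e" for w
  proof
    assume "card (nbrs (SLP p q (Suc c) d e) w) = 1"
    then obtain z where "nbrs (SLP p q (Suc c) d e) w = {z}" by (auto simp: card_1_singleton_iff)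
    moreover have "Pendant w 1 \<in> nbrs (SLP p q (Suc c) d e) w"
      using assms by (simp add: nbrs_SLP_core[OF w] slp_pendants_def)
    moreover have "\<exists>v. v \<in> slp_core_nbrs (Suc c) d e w"
      using w by (cases rule: slp_core_cases) (auto simp: slp_core_nbrs_simps)
    then obtain v where "v \<in> slp_core_nbrs (Suc c) d e w" by blast
    then have "v \<in> slp_core (Suc c) d e" "v \<in> nbrs (SLP p q (Suc c) d e) w"
      using slp_links_core by (auto simp: slp_core_nbrs_def nbrs_SLP_core[OF w])
    ultimately show False by (metis Pendant_notin_core singletonD)
  qed
  show *: "leaves (SLP p q (Suc c) d e) =
      {Pendant w l | w l. w \<in> slp_core (Suc c) d e \<and> l \<in> {1..slp_pendants p q (Suc c) w}}"
    unfolding leaves_def using core by (auto simp: SLP_def[THEN arg_cong[of _ _ pverts]] nbrs_SLP_Pendant)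
  show "interior_verts (SLP p q (Suc c) d e) = slp_core (Suc c) d e"
    unfolding interior_verts_def * by (auto simp: SLP_def)
qed

primrec slp_fun :: "(nat \<Rightarrow> real) \<Rightarrow> real \<Rightarrow> real \<Rightarrow> slp_vertex \<Rightarrow> real" where
  "slp_fun s l r (Spine i) = s i"
| "slp_fun s l r (ArmL j) = l"
| "slp_fun s l r (ArmR j) = r"
| "slp_fun s l r (Pendant w j) = 0"

text \<open>For a function constant on each bundle of arms, the system reduces to one equation per
  kind of core vertex.\<close>

lemma SLP_eigenfunction:
  assumes ge: "p > 0" "q > 0" and pos: "\<And>i. s i > 0" "l > 0" "r > 0"
    and first: "s 0 - s 1 + d * (s 0 - l) + p * s 0 = \<nu> * s 0"
    and final: "s (Suc c) - s c + e * (s (Suc c) - r) + p * s (Suc c) = \<nu> * s (Suc c)"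
    and inner: "\<And>i. 0 < i \<Longrightarrow> i \<le> c \<Longrightarrow> s i - s (i - 1) + (s i - s (i + 1)) + q * s i = \<nu> * s i"
    and armL: "l - s 0 + q * l = \<nu> * l" and armR: "r - s (Suc c) + q * r = \<nu> * r"
  defines "g \<equiv> slp_fun s l r"
  assumes w: "w \<in> interior_verts (SLP p q (Suc c) d e)"
  shows "g w > 0" "(\<Sum>v\<in>nbrs (SLP p q (Suc c) d e) w. g w - g v) = \<nu> * g w"
proof -
  have w': "w \<in> slp_core (Suc c) d e" using w by (simp add: interior_SLP[OF ge])
  show "g w > 0" using w' by (cases rule: slp_core_cases) (simp_all add: g_def pos)
  have fin: "finite (slp_core_nbrs (Suc c) d e w)"
    using w' by (cases rule: slp_core_cases) (simp_all add: slp_core_nbrs_simps)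
  have "slp_core_nbrs (Suc c) d e w \<inter> Pendant w ` {1..slp_pendants p q (Suc c) w} = {}"
    using slp_links_core[of "Suc c" d e] by (auto simp: slp_core_nbrs_def)
  then have "(\<Sum>v\<in>nbrs (SLP p q (Suc c) d e) w. g w - g v) = (\<Sum>v\<in>slp_core_nbrs (Suc c) d e w. g w - g v)
      + (\<Sum>v\<in>Pendant w ` {1..slp_pendants p q (Suc c) w}. g w - g v)"
    unfolding nbrs_SLP_core[OF w'] using fin by (intro sum.union_disjoint) auto
  also have "(\<Sum>v\<in>Pendant w ` {1..slp_pendants p q (Suc c) w}. g w - g v) = slp_pendants p q (Suc c) w * g w"
    by (subst sum.reindex) (auto simp: inj_on_def g_def)
  also have "(\<Sum>v\<in>slp_core_nbrs (Suc c) d e w. g w - g v) + slp_pendants p q (Suc c) w * g w = \<nu> * g w"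
    using w'
  proof (cases rule: slp_core_cases)
    case 1
    have "(\<Sum>v\<in>ArmL ` {1..d}. g w - g v) = d * (s 0 - l)"
      by (subst sum.reindex) (auto simp: inj_on_def g_def 1)
    then show ?thesis
      using first by (subst 1, subst slp_core_nbrs_simps, subst sum.insert) (auto simp: 1 g_def slp_pendants_def)
  next
    case 2
    have "(\<Sum>v\<in>ArmR ` {1..e}. g w - g v) = e * (s (Suc c) - r)"
      by (subst sum.reindex) (auto simp: inj_on_def g_def 2)
    then show ?thesis
      using final by (subst 2, subst slp_core_nbrs_simps, subst sum.insert) (auto simp: 2 g_def slp_pendants_def)
  next
    case (3 i)
    then show ?thesis using inner[of i] by (simp add: slp_core_nbrs_simps g_def slp_pendants_def)
  qed (use armL armR in \<open>simp_all add: slp_core_nbrs_simps g_def slp_pendants_def\<close>)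
  finally show "(\<Sum>v\<in>nbrs (SLP p q (Suc c) d e) w. g w - g v) = \<nu> * g w" .
qed

text \<open>Extends a labelling of the core to pendants; \<open>p x j\<close> is the j-th leaf
  chosen at the image \<open>x\<close>.\<close>

primrec slp_map :: "(nat \<Rightarrow> 'a) \<Rightarrow> (nat \<Rightarrow> 'a) \<Rightarrow> (nat \<Rightarrow> 'a) \<Rightarrow> ('a \<Rightarrow> nat \<Rightarrow> 'a) \<Rightarrow> slp_vertex \<Rightarrow> 'a" where
  "slp_map s l r p (Spine i) = s i"
| "slp_map s l r p (ArmL j) = l j"
| "slp_map s l r p (ArmR j) = r j"
| "slp_map s l r p (Pendant w j) = p (slp_map s l r p w) j"

section \<open>Isomorphisms between a tree and a star-like path tree\<close>

context dirichlet_tree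
begin

text \<open>A positive eigenfunction of \<open>H\<close> pulls back along the isomorphism, which
  preserves degrees and so leaves and interior.\<close>

lemma iso_eigenvalue:
  assumes iso: "graph_isomorphic T H"
    and g: "\<And>z. z \<in> interior_verts H \<Longrightarrow> g z > 0" "\<And>z. z \<in> leaves H \<Longrightarrow> g z = 0"
      "\<And>z. z \<in> interior_verts H \<Longrightarrow> (\<Sum>y\<in>nbrs H z. g z - g y) = \<nu> * g z"
  shows "first_dirichlet_eigenvalue T = \<nu>"
proof -
  have wf: "pair_wf_digraph T" ..
  obtain h where h: "inj_on h (pverts T)" "pverts H = h ` pverts T" "parcs H = map_prod h h ` parcs T"
    using iso unfolding graph_isomorphic_iff[OF wf] by blast
  have nb: "nbrs H (h x) = h ` nbrs T x" if "x \<in> pverts T" for x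
  proof (intro equalityI subsetI)
    fix z assume "z \<in> nbrs H (h x)"
    then obtain u v where "(u, v) \<in> parcs T" "h u = h x" "z = h v"
      by (auto simp: nbrs_def h(3))
    moreover from this have "u = x" using that h(1) in_arcsD1 by (meson inj_onD)
    ultimately show "z \<in> h ` nbrs T x" by (auto simp: nbrs_def)
  qed (force simp: nbrs_def h(3))
  have inj: "inj_on h (nbrs T x)" for x
    using h(1) by (rule inj_on_subset) (auto simp: nbrs_def dest: in_arcsD2)
  have card: "card (nbrs H (h x)) = card (nbrs T x)" if "x \<in> pverts T" for x
    unfolding nb[OF that] using inj by (rule card_image)
  have int: "h x \<in> interior_verts H" if "x \<in> S" for x
    using that card[of x] h(2) by (auto simp: interior_verts_def leaves_def)
  have lf: "h x \<in> leaves H" if "x \<in> leaves T" for x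
    using that card[of x] h(2) by (auto simp: leaves_def)
  show ?thesis
  proof (rule first_dirichlet_eigenvalueI)
    fix x assume x: "x \<in> S"
    then have "x \<in> pverts T" by (simp add: interior_verts_def)
    show "g (h x) > 0" using g(1) int[OF x] .
    have "lap (\<lambda>x. g (h x)) x = (\<Sum>y\<in>nbrs T x. g (h x) - g (h y))"
      using lf g(2) by (intro lap_eq[symmetric] x) auto
    also have "\<dots> = (\<Sum>y\<in>nbrs H (h x). g (h x) - g y)"
      unfolding nb[OF \<open>x \<in> pverts T\<close>] using inj by (subst sum.reindex) auto
    also have "\<dots> = \<nu> * g (h x)" using g(3) int[OF x] .
    finally show "lap (\<lambda>x. g (h x)) x = \<nu> * g (h x)" .
  qed
qed

lemma parcs_eq: "parcs T = E \<union> (SIGMA x:S. leaf_nbrs x) \<union> (SIGMA x:S. leaf_nbrs x)\<inverse>"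
proof (intro equalityI subrelI)
  fix u v assume uv: "(u, v) \<in> parcs T"
  then have V: "u \<in> S \<union> leaves T" "v \<in> S \<union> leaves T" using verts_Un in_arcsD1 in_arcsD2 by blast+
  have "v \<in> S" if "u \<in> leaves T"
    using leaf_nbrE[OF that] uv by (metis mem_Collect_eq nbrs_def singletonD)
  then show "(u, v) \<in> E \<union> (SIGMA x:S. leaf_nbrs x) \<union> (SIGMA x:S. leaf_nbrs x)\<inverse>"
    using uv V arcs_sym[OF uv] by (auto simp: E_def leaf_nbrs_def nbrs_def)
qed (auto simp: E_def leaf_nbrs_def nbrs_def arcs_sym)

text \<open>Recognises a star-like path tree from its interior and leaf counts. Arms and leaves
  enter as sets; any enumeration of them yields the isomorphism.\<close>

lemma iso_SLP_I:
  fixes s :: "nat \<Rightarrow> 'a" and p q c :: nat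
  assumes inj: "inj_on s {0..c}" and Seq: "S = s ` {0..c} \<union> L \<union> R"
    and disj: "s ` {0..c} \<inter> L = {}" "s ` {0..c} \<inter> R = {}" "L \<inter> R = {}"
    and Eeq: "E = F \<union> F\<inverse>" and F: "F = {(s i, s (Suc i)) | i. i < c} \<union> {s 0} \<times> L \<union> {s c} \<times> R"
    and cnt: "\<And>x. x \<in> S \<Longrightarrow> card (leaf_nbrs x) = (if x \<in> {s 0, s c} then p else q)"
  shows "graph_isomorphic T (SLP p q c (card L) (card R))"
proof -
  define d e where "d = card L" and "e = card R"
  have finLR: "finite L" "finite R" using finite_S unfolding Seq by auto
  then obtain l r where l: "bij_betw l {1..d} L" and r: "bij_betw r {1..e} R"
    unfolding d_def e_def using ex_bij_betw_nat_finite_1 by blast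
  have "\<forall>x. \<exists>h. bij_betw h {1..card (leaf_nbrs x)} (leaf_nbrs x)"
    using ex_bij_betw_nat_finite_1 finite_leaf_nbrs by blast
  then obtain t where t: "\<And>x. bij_betw (t x) {1..card (leaf_nbrs x)} (leaf_nbrs x)" by metis
  define \<Phi> where "\<Phi> = slp_map s l r t"
  define C where "C = slp_core c d e"
  define n where "n = slp_pendants p q c"
  have \<Phi>_simps [simp]: "\<Phi> (Spine i) = s i" "\<Phi> (ArmL i) = l i" "\<Phi> (ArmR i) = r i"
    "\<Phi> (Pendant w i) = t (\<Phi> w) i" for i w
    by (simp_all add: \<Phi>_def)
  have lL: "l ` {1..d} = L" "inj_on l {1..d}" and rR: "r ` {1..e} = R" "inj_on r {1..e}"
    using l r by (auto simp: bij_betw_def)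
  have core_img: "\<Phi> ` C = S"
    unfolding Seq lL(1)[symmetric] rR(1)[symmetric] by (simp add: C_def slp_core_def image_Un image_image)
  have core_inj: "inj_on \<Phi> C"
  proof -
    have "inj_on \<Phi> (Spine ` {0..c})" "inj_on \<Phi> (ArmL ` {1..d})" "inj_on \<Phi> (ArmR ` {1..e})"
      using inj lL(2) rR(2) by (auto intro!: inj_on_imageI simp: comp_def)
    moreover have "\<Phi> ` Spine ` {0..c} = s ` {0..c}" "\<Phi> ` ArmL ` {1..d} = L" "\<Phi> ` ArmR ` {1..e} = R"
      using lL rR by (simp_all add: image_image)
    ultimately show ?thesis unfolding C_def slp_core_def using disj
      by (intro inj_on_UnI) (simp_all only: image_Un Int_Un_distrib2 Un_empty_left)
  qed
  have n: "n w = card (leaf_nbrs (\<Phi> w))" if "w \<in> C" for w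
  proof -
    have ends: "Spine 0 \<in> C" "Spine c \<in> C" by (auto simp: C_def slp_core_def)
    have "\<Phi> w \<in> {s 0, s c} \<longleftrightarrow> w \<in> {Spine 0, Spine c}"
      \<comment> \<open>Injectivity on the core lets the spine-end test in
        \<open>slp_pendants\<close> be read off in the tree.\<close>
      using inj_on_eq_iff[OF core_inj that ends(1)] inj_on_eq_iff[OF core_inj that ends(2)] by simp
    moreover have "\<Phi> w \<in> S" using that core_img by blast
    ultimately show ?thesis by (simp only: n_def slp_pendants_def cnt)
  qed
  define P where "P = {Pendant w j | w j. w \<in> C \<and> j \<in> {1..n w}}"
  have t_img: "t (\<Phi> w) ` {1..n w} = leaf_nbrs (\<Phi> w)" "inj_on (t (\<Phi> w)) {1..n w}" if "w \<in> C" for w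
    using t[of "\<Phi> w"] n[OF that] by (auto simp: bij_betw_def)
  have t_in: "t (\<Phi> w) j \<in> leaf_nbrs (\<Phi> w)" if "w \<in> C" "j \<in> {1..n w}" for w j
    using t_img(1)[OF that(1)] that(2) by blast
  have SIG: "map_prod \<Phi> \<Phi> ` {(w, Pendant w j) | w j. w \<in> C \<and> j \<in> {1..n w}} = (SIGMA x:S. leaf_nbrs x)"
  proof (intro equalityI subrelI)
    fix x z assume "(x, z) \<in> (SIGMA x:S. leaf_nbrs x)"
    then have "x \<in> S" "z \<in> leaf_nbrs x" by auto
    then obtain w where w: "w \<in> C" "x = \<Phi> w" using core_img by auto
    then obtain j where "j \<in> {1..n w}" "z = t (\<Phi> w) j"
      using t_img(1)[OF w(1)] \<open>z \<in> leaf_nbrs x\<close> w(2) by blast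
    then show "(x, z) \<in> map_prod \<Phi> \<Phi> ` {(w, Pendant w j) | w j. w \<in> C \<and> j \<in> {1..n w}}"
      using w by (intro image_eqI[of _ _ "(w, Pendant w j)"]) auto
  qed (use t_in core_img in auto)
  have P_img: "\<Phi> ` P = leaves T"
  proof -
    have "P = snd ` {(w, Pendant w j) | w j. w \<in> C \<and> j \<in> {1..n w}}" by (force simp: P_def)
    then have "\<Phi> ` P = snd ` (map_prod \<Phi> \<Phi> ` {(w, Pendant w j) | w j. w \<in> C \<and> j \<in> {1..n w}})"
      by (simp add: image_image)
    then show ?thesis unfolding SIG leaves_eq by force
  qed
  have P_inj: "inj_on \<Phi> P"
  proof (rule inj_onI)
    fix u v assume "u \<in> P" "v \<in> P" and eq: "\<Phi> u = \<Phi> v"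
    then obtain w i w' j where u: "u = Pendant w i" "w \<in> C" "i \<in> {1..n w}"
      and v: "v = Pendant w' j" "w' \<in> C" "j \<in> {1..n w'}" by (auto simp: P_def)
    have "t (\<Phi> w) i \<in> leaf_nbrs (\<Phi> w)" "t (\<Phi> w') j \<in> leaf_nbrs (\<Phi> w')"
      using t_img(1) u v by blast+
    then have "\<Phi> w = \<Phi> w'" using eq u v leaf_nbrs_unique by auto
    then have "w = w'" using core_inj u v by (auto dest: inj_onD)
    moreover from this have "i = j" using eq u v t_img(2)[of w] by (auto dest: inj_onD)
    ultimately show "u = v" using u v by simp
  qed
  have verts: "pverts (SLP p q c d e) = C \<union> P" by (simp add: SLP_def C_def P_def n_def)
  have links_img: "map_prod \<Phi> \<Phi> ` slp_links c d e = F"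
  proof -
    have "slp_links c d e = (\<lambda>i. (Spine i, Spine (Suc i))) ` {..<c} \<union> (\<lambda>i. (Spine 0, ArmL i)) ` {1..d}
        \<union> (\<lambda>i. (Spine c, ArmR i)) ` {1..e}"
      by (auto simp: slp_links_def)
    then have "map_prod \<Phi> \<Phi> ` slp_links c d e = (\<lambda>i. (s i, s (Suc i))) ` {..<c} \<union> (\<lambda>i. (s 0, l i)) ` {1..d}
        \<union> (\<lambda>i. (s c, r i)) ` {1..e}"
      by (simp add: image_Un image_image)
    also have "(\<lambda>i. (s 0, l i)) ` {1..d} = {s 0} \<times> L" using lL(1) by auto
    also have "(\<lambda>i. (s c, r i)) ` {1..e} = {s c} \<times> R" using rR(1) by auto
    finally show ?thesis unfolding F by auto
  qed
  have conv: "map_prod \<Phi> \<Phi> ` X\<inverse> = (map_prod \<Phi> \<Phi> ` X)\<inverse>" for X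
    by force
  have arcs: "parcs (SLP p q c d e) = slp_edges p q c d e \<union> (slp_edges p q c d e)\<inverse>"
    by (simp add: SLP_def)
  have edges_img: "map_prod \<Phi> \<Phi> ` slp_edges p q c d e = F \<union> (SIGMA x:S. leaf_nbrs x)"
    unfolding slp_edges_eq image_Un links_img SIG[unfolded C_def n_def] ..
  have "map_prod \<Phi> \<Phi> ` parcs (SLP p q c d e) = parcs T"
    unfolding arcs image_Un conv edges_img parcs_eq Eeq by auto
  moreover have "inj_on \<Phi> (pverts (SLP p q c d e))"
    unfolding verts using core_inj P_inj core_img P_img verts_disj
    by (intro inj_on_UnI) auto
  moreover have "\<Phi> ` pverts (SLP p q c d e) = pverts T"
    unfolding verts image_Un core_img P_img verts_Un ..
  moreover have "parcs (SLP p q c d e) \<subseteq> pverts (SLP p q c d e) \<times> pverts (SLP p q c d e)"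
    unfolding arcs verts slp_edges_eq using slp_links_core[of c d e] by (auto simp: C_def P_def n_def)
  ultimately show ?thesis
    unfolding d_def e_def by (intro graph_isomorphicI) (auto intro: pair_wf_digraph)
qed

end

section \<open>The extremal trees\<close>

text \<open>\<mu> is the smaller root by the quadratic formula. Its range follows from (2h - 2)^2 <
  D < (2h + 2)^2.\<close>

lemma extremal_root:
  fixes h :: nat
  assumes "h \<ge> 2"
  defines "\<mu> \<equiv> (2 * real h + 2 - sqrt ((2 * real h + 2)\<^sup>2 - 16)) / 4"
  shows "\<mu>\<^sup>2 - (real h + 1) * \<mu> + 1 = 0" "0 < \<mu>" "\<mu> < 1"
proof -
  define D where "D = (2 * real h + 2)\<^sup>2 - 16"
  have h: "real h \<ge> 2" using assms by simp
  have less: "(2 * real h - 2)\<^sup>2 < D" "D < (2 * real h + 2)\<^sup>2"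
    using h by (simp_all add: D_def power2_eq_square algebra_simps)
  then have "D \<ge> 0" by (smt (verit) zero_le_power2)
  then have s: "(sqrt D)\<^sup>2 = (2 * real h + 2)\<^sup>2 - 16" by (simp add: D_def)
  have mu: "\<mu> = (2 * real h + 2 - sqrt D) / 4" by (simp add: \<mu>_def D_def)
  have "16 * (\<mu>\<^sup>2 - (real h + 1) * \<mu> + 1) = (sqrt D)\<^sup>2 - ((2 * real h + 2)\<^sup>2 - 16)"
    by (simp add: mu power2_eq_square field_simps)
  with s show "\<mu>\<^sup>2 - (real h + 1) * \<mu> + 1 = 0" by simp
  have "sqrt D < 2 * real h + 2"
    using less(2) h by (intro real_less_lsqrt) auto
  then show "0 < \<mu>" by (simp add: mu)
  have "2 * real h - 2 < sqrt D"
    using less(1) by (intro real_less_rsqrt)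
  then show "\<mu> < 1" by (simp add: mu)
qed

context dirichlet_tree
begin

text \<open>Cutting the spine leaves two stars whose Perron vectors are \<open>1 - \<mu>\<close> at the centre and 1 at
  the arms, scaled to agree at the two ends of the cut edge.\<close>

lemma iso_SLP_eigenvalue:
  fixes \<mu> :: real and a h :: nat
  assumes a: "a > 0" and h: "h \<ge> 2"
    and mu: "\<mu>\<^sup>2 - (real h + 1) * \<mu> + 1 = 0" "0 < \<mu>" "\<mu> < 1"
    and iso: "graph_isomorphic T (SLP (a + 1) a 1 (h - 1) (h - 1)) \<or>
      graph_isomorphic T (SLP (a + 1) a 2 (h - 2) (h - 1)) \<or>
      graph_isomorphic T (SLP (a + 1) a 3 (h - 2) (h - 2))"
  shows "first_dirichlet_eigenvalue T = a + \<mu>"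
proof -
  have mu2: "\<mu> * \<mu> = (real h + 1) * \<mu> - 1" using mu(1) by (simp add: power2_eq_square)
  have h': "real (h - Suc 0) = real h - 1" "real (h - 2) = real h - 2" using h by auto
  have eigenvalueI: "first_dirichlet_eigenvalue T = \<nu>"
    if "graph_isomorphic T (SLP (a + 1) a (Suc c) d e)"
      and "\<And>i. s i > 0" "l > 0" "r > 0"
      and "s 0 - s 1 + d * (s 0 - l) + real (a + 1) * s 0 = \<nu> * s 0"
      and "s (Suc c) - s c + e * (s (Suc c) - r) + real (a + 1) * s (Suc c) = \<nu> * s (Suc c)"
      and "\<And>i. 0 < i \<Longrightarrow> i \<le> c \<Longrightarrow> s i - s (i - 1) + (s i - s (i + 1)) + a * s i = \<nu> * s i"
      and "l - s 0 + a * l = \<nu> * l" "r - s (Suc c) + a * r = \<nu> * r"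
    for s :: "nat \<Rightarrow> real" and l r \<nu> :: real and c d e :: nat
  proof (rule iso_eigenvalue[OF that(1), of "slp_fun s l r"])
    have a': "a + 1 > 0" by simp
    fix z
    {
      assume "z \<in> interior_verts (SLP (a + 1) a (Suc c) d e)"
      note SLP_eigenfunction[OF a' a that(2-9) this]
      then show "slp_fun s l r z > 0"
        "(\<Sum>y\<in>nbrs (SLP (a + 1) a (Suc c) d e) z. slp_fun s l r z - slp_fun s l r y) = \<nu> * slp_fun s l r z"
        by simp_all
    next
      assume "z \<in> leaves (SLP (a + 1) a (Suc c) d e)"
      then show "slp_fun s l r z = 0" unfolding leaves_SLP[OF a' a] by auto
    }
  qed
  from iso consider (1) "graph_isomorphic T (SLP (a + 1) a (Suc 0) (h - 1) (h - 1))"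
    | (2) "graph_isomorphic T (SLP (a + 1) a (Suc 1) (h - 2) (h - 1))"
    | (3) "graph_isomorphic T (SLP (a + 1) a (Suc 2) (h - 2) (h - 2))"
    by (auto simp: numeral_2_eq_2 numeral_3_eq_3)
  then show ?thesis
  proof cases
    case 1
    show ?thesis
      by (rule eigenvalueI[OF 1, of "\<lambda>_. 1 - \<mu>" 1 1])
        (use mu mu2 in \<open>auto simp: h' algebra_simps\<close>)
  next
    case 2
    \<comment> \<open>The cut edge joins an arm of the left star to the centre of the right one. The
      left values are therefore scaled by \<open>w\<close>: \<open>w * w\<close> at its centre and
      \<open>w\<close> on its arms.\<close>
    define w where "w = 1 - \<mu>"
    have w: "w > 0" "\<mu> = 1 - w" "w * w = (real h - 1) * (1 - w)"
      using mu mu2 by (simp_all add: w_def algebra_simps)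
    have first: "w * w - w + (real h - 2) * (w * w - w) + real (a + 1) * (w * w) = (a + \<mu>) * (w * w)"
    proof -
      have "w * w - w + (real h - 2) * (w * w - w) + real (a + 1) * (w * w) - (a + \<mu>) * (w * w)
          = w * (w * w - (real h - 1) * (1 - w))"
        unfolding w(2) by (simp add: algebra_simps)
      then show ?thesis using w(3) by simp
    qed
    show ?thesis
    proof (rule eigenvalueI[OF 2, of "\<lambda>i. if i = 0 then w * w else w" w 1])
      fix i :: nat
      assume "0 < i" "i \<le> 1"
      then have "i = 1" by simp
      then show "(if i = 0 then w * w else w) - (if i - 1 = 0 then w * w else w) +
          ((if i = 0 then w * w else w) - (if i + 1 = 0 then w * w else w)) +
          real a * (if i = 0 then w * w else w) = (a + \<mu>) * (if i = 0 then w * w else w)"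
        unfolding w(2) by (simp add: algebra_simps)
    qed (unfold w(2), use w(1,3) first[unfolded w(2)] in \<open>simp_all add: h' algebra_simps\<close>)
  next
    case 3
    show ?thesis
      by (rule eigenvalueI[OF 3, of "\<lambda>i. if i \<in> {0, 3} then 1 - \<mu> else 1" 1 1])
        (use mu mu2 in \<open>auto simp: h' algebra_simps\<close>)
  qed
qed

text \<open>The spine is the path from \<open>c1\<close> to \<open>c2\<close>. Its length is 1, plus
  one for each of \<open>x0\<close>, \<open>y0\<close> that is an arm; such an arm moves to the
  spine.\<close>

lemma two_stars_iso:
  assumes A: "S = A1 \<union> A2" "A1 \<inter> A2 = {}" "card A1 = h" "card A2 = h"
    and c: "c1 \<in> A1" "c2 \<in> A2" "x0 \<in> A1" "y0 \<in> A2"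
    and cnt: "\<And>v. v \<in> S \<Longrightarrow> card (leaf_nbrs v) = (if v \<in> {c1, c2} then a + 1 else a)"
    and Eeq: "E = star c1 A1 \<union> star c2 A2 \<union> {(x0, y0), (y0, x0)}"
  shows "graph_isomorphic T (SLP (a + 1) a 1 (h - 1) (h - 1)) \<or>
    graph_isomorphic T (SLP (a + 1) a 2 (h - 2) (h - 1)) \<or>
    graph_isomorphic T (SLP (a + 1) a 3 (h - 2) (h - 2))"
proof -
  \<comment> \<open>Stated for arbitrary stars because the two cases with exactly one arm on the
    joining edge are mirror images.\<close>
  have mixed: "graph_isomorphic T (SLP (a + 1) a 2 (h - 2) (h - 1))"
    if A: "S = A1 \<union> A2" "A1 \<inter> A2 = {}" "card A1 = h" "card A2 = h"
      and c: "c1 \<in> A1" "c2 \<in> A2" "x0 \<in> A1" "x0 \<noteq> c1"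
      and cnt: "\<And>v. v \<in> S \<Longrightarrow> card (leaf_nbrs v) = (if v \<in> {c1, c2} then a + 1 else a)"
      and Eeq: "E = star c1 A1 \<union> star c2 A2 \<union> {(x0, c2), (c2, x0)}"
    for A1 A2 c1 c2 x0
  proof -
    define s where "s = (\<lambda>i::nat. if i = 0 then c1 else if i = 1 then x0 else c2)"
    have r: "{0..2::nat} = {0, 1, 2}" by auto
    have s_simps: "s 0 = c1" "s 1 = x0" "s 2 = c2" by (simp_all add: s_def)
    have img: "s ` {0..2} = {c1, x0, c2}" unfolding r by (simp add: s_simps[unfolded One_nat_def])
    have ne: "c1 \<noteq> c2" "x0 \<noteq> c2" using c A(2) by auto
    have "graph_isomorphic T (SLP (a + 1) a 2 (card (A1 - {c1, x0})) (card (A2 - {c2})))"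
    proof (rule iso_SLP_I[OF _ _ _ _ _ _ refl])
      show "inj_on s {0..2}" unfolding r using ne c(4) by (auto simp: s_def)
      have "{(s i, s (Suc i)) | i. i < 2} = (\<lambda>i. (s i, s (Suc i))) ` {..<2}" by auto
      also have "{..<2::nat} = {0, 1}" by auto
      also have "(\<lambda>i. (s i, s (Suc i))) ` {0, 1} = {(c1, x0), (x0, c2)}" by (simp add: s_def)
      finally show "E = ({(s i, s (Suc i)) | i. i < 2} \<union> {s 0} \<times> (A1 - {c1, x0}) \<union> {s 2} \<times> (A2 - {c2}))
         \<union> ({(s i, s (Suc i)) | i. i < 2} \<union> {s 0} \<times> (A1 - {c1, x0}) \<union> {s 2} \<times> (A2 - {c2}))\<inverse>"
        unfolding Eeq star_def s_simps using c by auto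
    qed (unfold img s_simps, use A c ne cnt in auto)
    moreover have "card (A1 - {c1, x0}) = h - 2" "card (A2 - {c2}) = h - 1"
      using A(3,4) c by (simp_all add: card_Diff_subset)
    ultimately show ?thesis by simp
  qed
  have ne: "c1 \<noteq> c2" "x0 \<noteq> c2" "c1 \<noteq> y0" "x0 \<noteq> y0" using c A(2) by auto
  have swap: "star c2 A2 \<union> star c1 A1 \<union> {(y0, x0), (x0, y0)} =
      star c1 A1 \<union> star c2 A2 \<union> {(x0, y0), (y0, x0)}"
    by auto
  consider "x0 = c1" "y0 = c2" | "x0 \<noteq> c1" "y0 = c2" | "x0 = c1" "y0 \<noteq> c2" | "x0 \<noteq> c1" "y0 \<noteq> c2" by blast
  then show ?thesis
  proof cases
    case 1
    define s where "s = (\<lambda>i::nat. if i = 0 then c1 else c2)"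
    have r: "{0..1::nat} = {0, 1}" by auto
    have s_simps: "s 0 = c1" "s 1 = c2" by (simp_all add: s_def)
    have img: "s ` {0..1} = {c1, c2}" unfolding r by (simp add: s_simps[unfolded One_nat_def])
    have "graph_isomorphic T (SLP (a + 1) a 1 (card (A1 - {c1})) (card (A2 - {c2})))"
    proof (rule iso_SLP_I[OF _ _ _ _ _ _ refl])
      show "inj_on s {0..1}" unfolding r using ne by (auto simp: s_def)
      have "{(s i, s (Suc i)) | i. i < 1} = {(c1, c2)}"
        by (auto simp: s_def)
      then show "E = ({(s i, s (Suc i)) | i. i < 1} \<union> {s 0} \<times> (A1 - {c1}) \<union> {s 1} \<times> (A2 - {c2}))
         \<union> ({(s i, s (Suc i)) | i. i < 1} \<union> {s 0} \<times> (A1 - {c1}) \<union> {s 1} \<times> (A2 - {c2}))\<inverse>"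
        unfolding Eeq star_def s_simps 1 by auto
    qed (unfold img s_simps, use A c ne cnt in auto)
    moreover have "card (A1 - {c1}) = h - 1" "card (A2 - {c2}) = h - 1"
      using A(3,4) c by simp_all
    ultimately show ?thesis by simp
  next
    case 2
    then show ?thesis using mixed[OF A c(1,2,3) _ cnt] Eeq by simp
  next
    case 3
    have "graph_isomorphic T (SLP (a + 1) a 2 (h - 2) (h - 1))"
    proof (rule mixed[of A2 A1 c2 c1 y0])
      show "E = star c2 A2 \<union> star c1 A1 \<union> {(y0, c1), (c1, y0)}" using Eeq swap 3 by simp
    qed (use A c cnt 3 in auto)
    then show ?thesis by simp
  next
    case 4
    define s where "s = (\<lambda>i::nat. if i = 0 then c1 else if i = 1 then x0 else if i = 2 then y0 else c2)"
    have r: "{0..3::nat} = {0, 1, 2, 3}" by auto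
    have s_simps: "s 0 = c1" "s 1 = x0" "s 2 = y0" "s 3 = c2" by (simp_all add: s_def)
    have img: "s ` {0..3} = {c1, x0, y0, c2}" unfolding r by (simp add: s_simps[unfolded One_nat_def])
    have "graph_isomorphic T (SLP (a + 1) a 3 (card (A1 - {c1, x0})) (card (A2 - {c2, y0})))"
    proof (rule iso_SLP_I[OF _ _ _ _ _ _ refl])
      show "inj_on s {0..3}" unfolding r using ne 4 by (auto simp: s_def)
      have "{(s i, s (Suc i)) | i. i < 3} = (\<lambda>i. (s i, s (Suc i))) ` {..<3}" by auto
      also have "{..<3::nat} = {0, 1, 2}" by auto
      also have "(\<lambda>i. (s i, s (Suc i))) ` {0, 1, 2} = {(c1, x0), (x0, y0), (y0, c2)}" by (simp add: s_def)
      finally show "E = ({(s i, s (Suc i)) | i. i < 3} \<union> {s 0} \<times> (A1 - {c1, x0}) \<union> {s 3} \<times> (A2 - {c2, y0}))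
         \<union> ({(s i, s (Suc i)) | i. i < 3} \<union> {s 0} \<times> (A1 - {c1, x0}) \<union> {s 3} \<times> (A2 - {c2, y0}))\<inverse>"
        unfolding Eeq star_def s_simps using c 4 by auto
    qed (unfold img s_simps, use A c ne cnt in auto)
    moreover have "card (A1 - {c1, x0}) = h - 2" "card (A2 - {c2, y0}) = h - 2"
      using A(3,4) c 4 by (simp_all add: card_Diff_subset)
    ultimately show ?thesis by simp
  qed
qed

end

theorem theorem3p9:
  fixes T :: "'a pair_pre_digraph" and a b k :: nat
  assumes "a \<ge> 1" and "k \<ge> 4" and "even k" and "b = a * k + 2"
    and "tree_graph T"
    and "card (interior_verts T) = k" and "card (leaves T) = b"
  shows "first_dirichlet_eigenvalue T
           \<le> (real k + 4 * real a + 2 - sqrt ((real k + 2)\<^sup>2 - 16)) / 4 \<and>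
         (first_dirichlet_eigenvalue T
            = (real k + 4 * real a + 2 - sqrt ((real k + 2)\<^sup>2 - 16)) / 4 \<longleftrightarrow>
          graph_isomorphic T (SLP (a + 1) a 1 ((k - 2) div 2) ((k - 2) div 2)) \<or>
          graph_isomorphic T (SLP (a + 1) a 2 ((k - 4) div 2) ((k - 2) div 2)) \<or>
          graph_isomorphic T (SLP (a + 1) a 3 ((k - 4) div 2) ((k - 4) div 2)))"
  proof -
  obtain h where k: "k = 2 * h" using \<open>even k\<close> by (auto elim: evenE)
  have h: "h \<ge> 2" using \<open>k \<ge> 4\<close> k by simp
  define \<mu> where "\<mu> = (2 * real h + 2 - sqrt ((2 * real h + 2)\<^sup>2 - 16)) / 4"
  note mu = extremal_root[OF h, folded \<mu>_def]
  have bound: "(real k + 4 * real a + 2 - sqrt ((real k + 2)\<^sup>2 - 16)) / 4 = a + \<mu>"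
    by (simp add: \<mu>_def k field_simps)
  have arms: "(k - 2) div 2 = h - 1" "(k - 4) div 2 = h - 2" using k by auto
  interpret dirichlet_tree T
    using assms by unfold_locales auto
  have card: "card (interior_verts T) = 2 * h" "card (leaves T) = a * (2 * h) + 2"
    using assms k by auto
  have a: "a > 0" using \<open>a \<ge> 1\<close> by simp
  note le = first_eigenvalue_bound(1)[OF card(1) h card(2) mu]
  note eq = first_eigenvalue_bound(2)[OF card(1) h card(2) mu]
  show ?thesis
    unfolding bound arms
  proof (intro conjI iffI)
    show "first_dirichlet_eigenvalue T \<le> a + \<mu>" by (rule le)
  next
    assume "first_dirichlet_eigenvalue T = a + \<mu>"
    from eq[OF this] obtain c1 c2 A1 A2 x0 y0 where *:
      "interior_verts T = A1 \<union> A2" "A1 \<inter> A2 = {}" "card A1 = h" "card A2 = h"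
      "c1 \<in> A1" "c2 \<in> A2" "x0 \<in> A1" "y0 \<in> A2"
      "\<forall>v\<in>interior_verts T. card (leaf_nbrs v) = (if v \<in> {c1, c2} then a + 1 else a)"
      "E = star c1 A1 \<union> star c2 A2 \<union> {(x0, y0), (y0, x0)}"
      by metis
    show "graph_isomorphic T (SLP (a + 1) a 1 (h - 1) (h - 1)) \<or>
        graph_isomorphic T (SLP (a + 1) a 2 (h - 2) (h - 1)) \<or>
        graph_isomorphic T (SLP (a + 1) a 3 (h - 2) (h - 2))"
      by (rule two_stars_iso[OF *(1-8) bspec[OF *(9)] *(10)])
  next
    assume "graph_isomorphic T (SLP (a + 1) a 1 (h - 1) (h - 1)) \<or>
        graph_isomorphic T (SLP (a + 1) a 2 (h - 2) (h - 1)) \<or>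
        graph_isomorphic T (SLP (a + 1) a 3 (h - 2) (h - 2))"
    then show "first_dirichlet_eigenvalue T = a + \<mu>"
      by (rule iso_SLP_eigenvalue[OF a h mu])
  qed
qed

end
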